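(* Let $0<q<1$ and let $(c,d)$ be an admissible pair: either $d=\bar c\in\mathbb C\setminus\mathbb R$, or $c,d$ are real of the same sign with $q<cd^{-1}<q^{-1}$. Let $\varphi^{ASC}_{\lambda|N}$ be the $N$-variate Al-Salam--Carlitz polynomials and $\Phi^{ASC}_\lambda$ the Al-Salam--Carlitz symmetric functions. Then for every partition $\lambda$, as $N\to\infty$, $$\varphi^{ASC}_{\lambda|N}(\,\cdot\,;q;cq^{1-N},dq^{1-N})\longrightarrow\Phi^{ASC}_\lambda(\,\cdot\,;q;c,d)$$ in the sense of convergence of elements of $\mathrm{Sym}(N)$ to an element of $\mathrm{Sym}$ defined in the context.
   Context: Notation: $(x;q)_n=\prod_{k=0}^{n-1}(1-xq^k)$ for $n\ge0$. $\ell(\lambda)$ is the number of nonzero parts, $|\lambda|=\sum\lambda_i$, $n(\lambda)=\sum_i(i-1)\lambda_i$, $\lambda'$ is the transposed partition (so $n(\lambda')=\sum_i\binom{\lambda_i}2$), $\mathbb Y(N)$ is the set of partitions with at most $N$ nonzero parts. $\mathrm{Sym}$ is the algebra of symmetric functions over $\mathbb C$, $\mathrm{Sym}(N)$ the symmetric polynomials in $N$ variables, the subscript $\le d$ means degree at most $d$. $V(x_1,\dots,x_N)=\prod_{i<j}(x_i-x_j)$. For variables $X=(x_1,x_2,\dots)$, $F(Xc)=F(cx_1,cx_2,\dots)$. Convergence: $F_N\in\mathrm{Sym}(N)$ converges to $F\in\mathrm{Sym}$ if $\sup_N\deg F_N<\infty$ and, for every sufficiently large $d$, $\iota_{d,N}(F_N)\to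 F$ in the finite-dimensional space $\mathrm{Sym}_{\le d}$, where for $N\ge d$, $\iota_{d,N}:\mathrm{Sym}_{\le d}(N)\to\mathrm{Sym}_{\le d}$ is the inverse of the isomorphism $F\mapsto F(x_1,\dots,x_N,0,0,\dots)$. Univariate Al-Salam--Carlitz polynomials: for nonzero $c,d$, $\varphi^{ASC}_n(x;q;c,d)$ is the unique monic polynomial of degree $n$ with $D^{ASC}\varphi^{ASC}_n=cd(q^n-1)\varphi^{ASC}_n$, where $$D^{ASC}=\left(c-\frac1x\right)\left(d-\frac1x\right)(T_q-1)+\frac q{x^2}(T_{q^{-1}}-1),\qquad T_{q^{\pm1}}f(x)=f(q^{\pm1}x).$$ $N$-variate polynomials: for $\lambda\in\mathbb Y(N)$, $$\varphi^{ASC}_{\lambda|N}(x_1,\dots,x_N;q;cq^{1-N},dq^{1-N})=\frac{\det[\varphi^{ASC}_{\lambda_i+N-i}(x_j;q;cq^{1-N},dq^{1-N})]_{i,j=1}^N}{V(x_1,\dots,x_N)}.$$ Interpolation functions: $(x\mid c_0,c_1,\dots)^m=\prod_{i=0}^{m-1}(x-c_i)$; for $\mu\in\mathbb Y(N)$, $s_{\mu|N}(x_1,\dots,x_N\mid c_0,c_1,\dots)=\det[(x_j\mid c_0,c_1,\dots)^{\mu_i+N-i}]_{i,j=1}^N/V(x_1,\dots,x_N)$; $I^A_\mu(\cdot;q)\in\mathrm{Sym}$ is the limit as $N\to\infty$ (which exists) of $s_{\mu|N}(\cdot\mid q^{N-1},q^{N-2},\dots)$. Al-Salam--Carlitz symmetric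 functions: $\Phi^{ASC}_\lambda(X;q;c,d)=\sum_{\mu\subseteq\lambda}\sigma^{ASC}(\lambda,\mu;q;c,d)\,I^A_\mu(Xc;q)$ with $$\sigma^{ASC}(\lambda,\mu;q;c,d)=c^{-|\lambda|}\left(-\frac cd\right)^{|\lambda|-|\mu|}q^{n(\mu')-n(\mu)-n(\lambda')+n(\lambda)}\det\left[\frac1{(q;q)_{\lambda_j-j-\mu_k+k}}\right]_{j,k=1}^{\ell(\lambda)};$$ an entry with $\lambda_j-j-\mu_k+k<0$ is $0$, and the empty determinant is $1$. *)

theory Defs
  imports
    Complex_Main
    "HOL-Library.Poly_Mapping"
    "HOL-Combinatorics.Permutations"
    "HOL-Computational_Algebra.Polynomial"
    "Jordan_Normal_Form.Determinant"
begin

text \<open>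
  All indices are 0-based: \<open>lam i\<close> is the part $\lambda_{i+1}$, and the variable with index \<open>i\<close>
  is $x_{i+1}$, so that $\lambda_i + N - i$ becomes \<open>lam i + N - 1 - i\<close> and $(i-1)\lambda_i$
  becomes \<open>i * lam i\<close>.
\<close>

definition is_partition :: "(nat \<Rightarrow> nat) \<Rightarrow> bool" where
  "is_partition lam \<longleftrightarrow> antimono lam \<and> finite {i. lam i \<noteq> 0}"

definition part_length :: "(nat \<Rightarrow> nat) \<Rightarrow> nat" where
  "part_length lam = card {i. lam i \<noteq> 0}"

definition part_size :: "(nat \<Rightarrow> nat) \<Rightarrow> nat" where
  "part_size lam = (\<Sum>i | lam i \<noteq> 0. lam i)"

definition part_n :: "(nat \<Rightarrow> nat) \<Rightarrow> nat" where
  "part_n lam = (\<Sum>i | lam i \<noteq> 0. i * lam i)"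

definition part_transpose :: "(nat \<Rightarrow> nat) \<Rightarrow> nat \<Rightarrow> nat" where
  "part_transpose lam j = card {i. j < lam i}"

definition part_subset :: "(nat \<Rightarrow> nat) \<Rightarrow> (nat \<Rightarrow> nat) \<Rightarrow> bool" where
  "part_subset mu lam \<longleftrightarrow> (\<forall>i. mu i \<le> lam i)"

type_synonym monomial = "nat \<Rightarrow>\<^sub>0 nat"
type_synonym mvpoly = "monomial \<Rightarrow>\<^sub>0 complex"

definition mdeg :: "monomial \<Rightarrow> nat" where
  "mdeg m = (\<Sum>i\<in>Poly_Mapping.keys m. Poly_Mapping.lookup m i)"

definition Const :: "complex \<Rightarrow> mvpoly" where
  "Const a = Poly_Mapping.single 0 a"

definition Var :: "nat \<Rightarrow> mvpoly" where
  "Var i = Poly_Mapping.single (Poly_Mapping.single i 1) 1"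

definition SymN :: "nat \<Rightarrow> mvpoly set" where
  "SymN N = {p. (\<forall>m\<in>Poly_Mapping.keys p. Poly_Mapping.keys m \<subseteq> {..<N}) \<and>
     (\<forall>\<pi>. \<pi> permutes {..<N} \<longrightarrow>
       (\<forall>m. Poly_Mapping.lookup p (Poly_Mapping.map_key \<pi> m) = Poly_Mapping.lookup p m))}"

definition SymN_le :: "nat \<Rightarrow> nat \<Rightarrow> mvpoly set" where
  "SymN_le d N = {p \<in> SymN N. \<forall>m\<in>Poly_Mapping.keys p. mdeg m \<le> d}"

text \<open>
  A symmetric function is a formal power series in $x_1, x_2, \ldots$ of bounded degree that is
  invariant under permutations of the variables; it is represented by its family of coefficients.
\<close>

definition Sym_le :: "nat \<Rightarrow> (monomial \<Rightarrow> complex) set" where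
  "Sym_le d = {F. (\<forall>m. F m \<noteq> 0 \<longrightarrow> mdeg m \<le> d) \<and>
     (\<forall>\<pi>. bij \<pi> \<longrightarrow> (\<forall>m. F (Poly_Mapping.map_key \<pi> m) = F m))}"

text \<open>
  $F \mapsto F(x_1,\ldots,x_N,0,0,\ldots)$. For \<open>F \<in> Sym_le d\<close> the coefficient function on the right
  has finite support, so \<open>Abs_poly_mapping\<close> is applied inside its domain.
\<close>

definition restrict_vars :: "nat \<Rightarrow> (monomial \<Rightarrow> complex) \<Rightarrow> mvpoly" where
  "restrict_vars N F = Abs_poly_mapping (\<lambda>m. if Poly_Mapping.keys m \<subseteq> {..<N} then F m else 0)"

text \<open>$\iota_{d,N}$; meaningful for $N \ge d$ and arguments in \<open>SymN_le d N\<close>.\<close>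

definition sym_iota :: "nat \<Rightarrow> nat \<Rightarrow> mvpoly \<Rightarrow> (monomial \<Rightarrow> complex)" where
  "sym_iota d N = inv_into (Sym_le d) (restrict_vars N)"

text \<open>
  Convergence of a sequence $F_N \in \mathrm{Sym}(N)$, defined for $N \ge N_0$, to $G \in \mathrm{Sym}$.
  The coefficients of the monomials are linear functionals separating the points of the
  finite-dimensional space $\mathrm{Sym}_{\le d}$, so convergence in that space is convergence of
  every coefficient.
\<close>

definition sym_converges :: "nat \<Rightarrow> (nat \<Rightarrow> mvpoly) \<Rightarrow> (monomial \<Rightarrow> complex) \<Rightarrow> bool" where
  "sym_converges N0 F G \<longleftrightarrow>
     (\<exists>D. \<forall>N\<ge>N0. F N \<in> SymN_le D N) \<and>
     (\<forall>\<^sub>F d in sequentially. G \<in> Sym_le d \<and>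
        (\<forall>m. (\<lambda>N. sym_iota d N (F N) m) \<longlonglongrightarrow> G m))"

text \<open>$F(Xc) = F(cx_1, cx_2, \ldots)$.\<close>

definition sym_scale :: "complex \<Rightarrow> (monomial \<Rightarrow> complex) \<Rightarrow> (monomial \<Rightarrow> complex)" where
  "sym_scale c F = (\<lambda>m. c ^ mdeg m * F m)"

definition subst_var :: "complex poly \<Rightarrow> nat \<Rightarrow> mvpoly" where
  "subst_var f j = poly (map_poly Const f) (Var j)"

definition vandermonde :: "nat \<Rightarrow> mvpoly" where
  "vandermonde N = (\<Prod>(i, j) \<in> {(i, j). i < j \<and> j < N}. Var i - Var j)"

text \<open>
  $\det[f_{\lambda_i+N-i}(x_j)]_{i,j=1}^N / V(x_1,\ldots,x_N)$, the division being exact division in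
  the polynomial ring (an integral domain).
\<close>

definition det_quotient :: "nat \<Rightarrow> (nat \<Rightarrow> complex poly) \<Rightarrow> (nat \<Rightarrow> nat) \<Rightarrow> mvpoly" where
  "det_quotient N f lam =
     (THE p. p * vandermonde N = det (mat N N (\<lambda>(i, j). subst_var (f (lam i + N - 1 - i)) j)))"

definition D_ASC :: "complex \<Rightarrow> complex \<Rightarrow> complex \<Rightarrow> (complex \<Rightarrow> complex) \<Rightarrow> (complex \<Rightarrow> complex)" where
  "D_ASC q c d f = (\<lambda>x. (c - 1 / x) * (d - 1 / x) * (f (q * x) - f x)
                        + q / x ^ 2 * (f (inverse q * x) - f x))"

text \<open>
  $D^{ASC}$ has rational coefficients with a pole only at $0$, so the eigenvalue equation between
  rational functions is stated at all nonzero points.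
\<close>

definition ASC_poly :: "complex \<Rightarrow> complex \<Rightarrow> complex \<Rightarrow> nat \<Rightarrow> complex poly" where
  "ASC_poly q c d n =
     (THE p. Polynomial.degree p = n \<and> lead_coeff p = 1 \<and>
        (\<forall>x. x \<noteq> 0 \<longrightarrow> D_ASC q c d (poly p) x = c * d * (q ^ n - 1) * poly p x))"

definition ASC_polyN :: "nat \<Rightarrow> complex \<Rightarrow> complex \<Rightarrow> complex \<Rightarrow> (nat \<Rightarrow> nat) \<Rightarrow> mvpoly" where
  "ASC_polyN N q c d lam = det_quotient N (ASC_poly q c d) lam"

definition ASC_admissible :: "real \<Rightarrow> complex \<Rightarrow> complex \<Rightarrow> bool" where
  "ASC_admissible q c d \<longleftrightarrow>
     (c \<notin> \<real> \<and> d = cnj c) \<or>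
     (\<exists>a b :: real. c = of_real a \<and> d = of_real b \<and> (0 < a \<and> 0 < b \<or> a < 0 \<and> b < 0) \<and>
        q < a / b \<and> a / b < 1 / q)"

definition shifted_power :: "(nat \<Rightarrow> complex) \<Rightarrow> nat \<Rightarrow> complex poly" where
  "shifted_power cs m = (\<Prod>i<m. [:- cs i, 1:])"

definition interp_schur :: "nat \<Rightarrow> (nat \<Rightarrow> complex) \<Rightarrow> (nat \<Rightarrow> nat) \<Rightarrow> mvpoly" where
  "interp_schur N cs mu = det_quotient N (shifted_power cs) mu"

text \<open>The sequence $q^{N-1}, q^{N-2}, \ldots$ continues to negative powers of $q$.\<close>

definition I_A :: "complex \<Rightarrow> (nat \<Rightarrow> nat) \<Rightarrow> (monomial \<Rightarrow> complex)" where
  "I_A q mu =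
     (THE F. sym_converges (part_length mu)
        (\<lambda>N. interp_schur N (\<lambda>i. q powi (int N - 1 - int i)) mu) F)"

definition qpoch :: "complex \<Rightarrow> complex \<Rightarrow> nat \<Rightarrow> complex" where
  "qpoch x q n = (\<Prod>k<n. 1 - x * q ^ k)"

definition sigma_entry :: "complex \<Rightarrow> int \<Rightarrow> complex" where
  "sigma_entry q k = (if k < 0 then 0 else 1 / qpoch q q (nat k))"

definition sigma_ASC ::
    "complex \<Rightarrow> complex \<Rightarrow> complex \<Rightarrow> (nat \<Rightarrow> nat) \<Rightarrow> (nat \<Rightarrow> nat) \<Rightarrow> complex" where
  "sigma_ASC q c d lam mu =
     c powi (- int (part_size lam))
     * (- (c / d)) powi (int (part_size lam) - int (part_size mu))
     * q powi (int (part_n (part_transpose mu)) - int (part_n mu)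
               - int (part_n (part_transpose lam)) + int (part_n lam))
     * det (mat (part_length lam) (part_length lam)
         (\<lambda>(j, k). sigma_entry q (int (lam j) - int j - int (mu k) + int k)))"

definition Phi_ASC :: "complex \<Rightarrow> complex \<Rightarrow> complex \<Rightarrow> (nat \<Rightarrow> nat) \<Rightarrow> (monomial \<Rightarrow> complex)" where
  "Phi_ASC q c d lam =
     (\<lambda>m. \<Sum>mu | is_partition mu \<and> part_subset mu lam.
        sigma_ASC q c d lam mu * sym_scale c (I_A q mu) m)"

end

theory Submission
  imports Defs
begin

text \<open>
  The univariate Al-Salam--Carlitz polynomial with parameters $c' = cq^{1-N}$, $d' = dq^{1-N}$ has an
  explicit triangular expansion in the polynomials $\prod_{i<k}(x - 1/(c'q^i))$, on which $D^{ASC}$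
  acts bidiagonally. The nodes are $1/(c'q^i) = q^{N-1-i}/c$, those of $I^A_\mu(Xc;q)$, so the
  Cauchy--Binet formula expands $\varphi^{ASC}_{\lambda|N}$ in interpolation Schur polynomials; the
  $N \times N$ determinants reduce to size $\ell(\lambda)$ by triangularity, and their entries
  converge, the normalising powers of $q$ depending on $N$ only through constants that cancel. The
  same expansion, applied to the interpolation Schur polynomials in terms of ordinary Schur
  polynomials, which are stable in $N$, shows that $I^A_\mu$ exists.
\<close>

subsection \<open>Ring homomorphisms of the polynomial ring\<close>

text \<open>The nodes are dictated by the operator. Dilation by \<open>q\<close> loses the node
  \<open>1/c\<close> and gains one at the other end; the factor \<open>c - 1/x\<close> restores the
  lost node, and the \<open>q / x^2\<close> term cancels the pole that the factor
  \<open>d - 1/x\<close> leaves. The resulting two-term recursion has a solution free of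
  \<open>c\<close>, so \<open>c\<close> lives only in the nodes. The scaling of \<open>d\<close> is
  equally forced. Degrees are \<open>n = N - 1 + (a - i)\<close>, so \<open>C(n,2) - C(k,2)\<close>
  grows linearly in \<open>N\<close> when \<open>n - k\<close> is fixed, and the factor
  \<open>q^((N-1)(n-k))\<close> coming from \<open>d q^(1-N)\<close> offsets this growth. What
  remains is a q-binomial coefficient whose lower index tends to infinity, hence the limit
  \<open>1 / (q;q)_(n-k)\<close>. The obstacle is that neither family is stable when a variable is
  added: the nodes move with \<open>N\<close>. All limits are therefore taken for one monomial
  coefficient at a time, in sums over the partitions inside a fixed one, an index set independent of
  \<open>N\<close>. Convergence in the sense of the definition, with its chosen inverse of the
  restriction map, is first reduced to this.\<close>

lemma Const_add: "Const (a + b) = Const a + Const b"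
  by (simp add: Const_def single_add)

lemma Const_mult: "Const (a * b) = Const a * Const b"
  by (simp add: Const_def mult_single)

interpretation Const_hom: comm_ring_hom Const
  by standard (simp_all add: Const_add Const_mult, simp_all add: Const_def)

lemma Const_power: "Const (a ^ n) = Const a ^ n"
  by (rule Const_hom.hom_power)

lemma Const_mult_lookup:
  "Poly_Mapping.lookup (Const a * p) m = a * Poly_Mapping.lookup p m"
proof -
  have "Const a * p = Poly_Mapping.map ((*) a) p"
    by (simp add: Const_def mult_map_scale_conv_mult)
  thus ?thesis
    by (cases "Poly_Mapping.lookup p m = 0") (auto simp: Poly_Mapping.map.rep_eq when_def)
qed

lemma Const_eq_iff [simp]: "Const a = Const b \<longleftrightarrow> a = b"
  by (metis Const_def lookup_single_eq)

lemma Var_eq_iff [simp]: "Var i = Var j \<longleftrightarrow> i = j"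
proof
  assume "Var i = Var j"
  hence "Poly_Mapping.lookup (Var i) (Poly_Mapping.single i 1) = Poly_Mapping.lookup (Var j) (Poly_Mapping.single i 1)"
    by simp
  hence "Poly_Mapping.single j 1 = Poly_Mapping.single i (1::nat)"
    by (auto simp: Var_def lookup_single when_def split: if_splits)
  hence "Poly_Mapping.keys (Poly_Mapping.single j (1::nat)) = Poly_Mapping.keys (Poly_Mapping.single i (1::nat))"
    by simp
  thus "i = j" by simp
qed auto

lemma mvpoly_single_induct:
  fixes p :: mvpoly
  assumes "P 0" "\<And>m a p. P p \<Longrightarrow> P (Poly_Mapping.single m a + p)"
  shows "P p"
proof (induction p rule: update_induct)
  case const thus ?case by (rule assms(1))
next
  case (update p m a)
  have "Poly_Mapping.update m a p = Poly_Mapping.single m a + p"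
    using update by (intro poly_mapping_eqI) (auto simp: lookup_update lookup_add lookup_single when_def in_keys_iff)
  thus ?case using assms(2) update by metis
qed

text \<open>Polynomials are built up term by term, so multiplicativity of an additive map can be
  tested on single terms. The homomorphisms that permute, scale or kill variables all rest on
  this.\<close>

lemma mvpoly_multI:
  fixes T :: "mvpoly \<Rightarrow> mvpoly"
  assumes add: "\<And>p r. T (p + r) = T p + T r"
    and sing: "\<And>m n a b. T (Poly_Mapping.single m a * Poly_Mapping.single n b) =
       T (Poly_Mapping.single m a) * T (Poly_Mapping.single n b)"
  shows "T (p * r) = T p * T r"
proof -
  have T0: "T 0 = 0" using add[of 0 0] by simp
  have 1: "T (Poly_Mapping.single m a * r) = T (Poly_Mapping.single m a) * T r" for m a r
    by (induction r rule: mvpoly_single_induct) (simp_all add: T0 distrib_left add sing)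
  show ?thesis
    by (induction p rule: mvpoly_single_induct) (simp_all add: T0 distrib_right add 1)
qed

text \<open>The inner \<open>map_key\<close> acts on exponent vectors, the outer one on
  coefficients. The result substitutes \<open>Var (\<pi> i)\<close> for \<open>Var i\<close>; being
  fixed by it for all \<pi> permuting \<open>{..<N}\<close> is the invariance clause of
  \<open>SymN\<close>.\<close>

definition perm_vars :: "(nat \<Rightarrow> nat) \<Rightarrow> mvpoly \<Rightarrow> mvpoly" where
  "perm_vars \<pi> = Poly_Mapping.map_key (Poly_Mapping.map_key \<pi>)"

lemma lookup_map_key: "inj f \<Longrightarrow> Poly_Mapping.lookup (Poly_Mapping.map_key f p) k = Poly_Mapping.lookup p (f k)"
  by (simp add: map_key.rep_eq)

lemma map_key_inverse:
  assumes "bij \<pi>"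
  shows "Poly_Mapping.map_key \<pi> (Poly_Mapping.map_key (inv_into UNIV \<pi>) m) = m"
    and "Poly_Mapping.map_key (inv_into UNIV \<pi>) (Poly_Mapping.map_key \<pi> m) = m"
  using assms
  by (auto intro!: poly_mapping_eqI simp: lookup_map_key bij_is_inj bij_imp_bij_inv bij_is_surj surj_f_inv_f)

lemma bij_map_key: "bij \<pi> \<Longrightarrow> bij (Poly_Mapping.map_key \<pi> :: monomial \<Rightarrow> monomial)"
  using map_key_inverse by (intro o_bij[of "Poly_Mapping.map_key (inv_into UNIV \<pi>)"]) (auto simp: fun_eq_iff)

lemma inj_map_key: "bij \<pi> \<Longrightarrow> inj (Poly_Mapping.map_key \<pi> :: monomial \<Rightarrow> monomial)"
  by (simp add: bij_map_key bij_is_inj)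

lemma lookup_perm_vars:
  "bij \<pi> \<Longrightarrow> Poly_Mapping.lookup (perm_vars \<pi> p) m = Poly_Mapping.lookup p (Poly_Mapping.map_key \<pi> m)"
  by (simp add: perm_vars_def lookup_map_key inj_map_key)

lemma perm_vars_single:
  assumes "bij \<pi>"
  shows "perm_vars \<pi> (Poly_Mapping.single (Poly_Mapping.map_key \<pi> m) a) = Poly_Mapping.single m a"
  using assms by (intro poly_mapping_eqI)
    (auto simp: lookup_perm_vars lookup_single when_def dest: inj_map_key injD)

lemma perm_vars_hom:
  assumes "bij \<pi>"
  shows "comm_ring_hom (perm_vars \<pi>)"
proof
  show add: "perm_vars \<pi> (p + r) = perm_vars \<pi> p + perm_vars \<pi> r" for p r
    using assms by (intro poly_mapping_eqI) (simp add: lookup_perm_vars lookup_add)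
  show "perm_vars \<pi> 0 = 0"
    using assms by (intro poly_mapping_eqI) (simp add: lookup_perm_vars)
  show "perm_vars \<pi> 1 = 1"
    using perm_vars_single[OF assms, of 0 1] assms by (simp add: bij_is_inj)
  show "perm_vars \<pi> (p * r) = perm_vars \<pi> p * perm_vars \<pi> r" for p r
  proof (rule mvpoly_multI[OF add])
    fix m n a b
    let ?k = "Poly_Mapping.map_key (inv_into UNIV \<pi>) :: monomial \<Rightarrow> monomial"
    have s: "perm_vars \<pi> (Poly_Mapping.single m a) = Poly_Mapping.single (?k m) a" for m a
      using perm_vars_single[OF assms, of "?k m" a] by (simp add: map_key_inverse assms)
    have "?k (m + n) = ?k m + ?k n"
      using assms by (simp add: map_key_plus bij_is_inj bij_imp_bij_inv)
    thus "perm_vars \<pi> (Poly_Mapping.single m a * Poly_Mapping.single n b) =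
      perm_vars \<pi> (Poly_Mapping.single m a) * perm_vars \<pi> (Poly_Mapping.single n b)"
      by (simp add: mult_single s)
  qed
qed

lemma perm_vars_Const: "bij \<pi> \<Longrightarrow> perm_vars \<pi> (Const a) = Const a"
  using perm_vars_single[of \<pi> 0 a] by (simp add: Const_def bij_is_inj)

lemma perm_vars_Var: "bij \<pi> \<Longrightarrow> perm_vars \<pi> (Var i) = Var (\<pi> i)"
  using perm_vars_single[of \<pi> "Poly_Mapping.single (\<pi> i) 1" 1]
  by (simp add: Var_def bij_is_inj)

text \<open>A diagonal map, and a ring homomorphism when \<open>w\<close> is multiplicative on
  monomials. The weight \<open>c ^ mdeg m\<close> rescales all variables; the indicator of the
  monomials in the first \<open>N\<close> variables sets the others to zero.\<close>

definition weight_vars :: "(monomial \<Rightarrow> complex) \<Rightarrow> mvpoly \<Rightarrow> mvpoly" where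
  "weight_vars w = Poly_Mapping.mapp (\<lambda>m a. w m * a)"

lemma lookup_weight_vars: "Poly_Mapping.lookup (weight_vars w p) m = w m * Poly_Mapping.lookup p m"
  by (simp add: weight_vars_def lookup_mapp when_def in_keys_iff)

lemma weight_vars_single: "weight_vars w (Poly_Mapping.single m a) = Poly_Mapping.single m (w m * a)"
  by (intro poly_mapping_eqI) (auto simp: lookup_weight_vars lookup_single when_def)

lemma weight_vars_hom:
  assumes "w 0 = 1" "\<And>m n. w (m + n) = w m * w n"
  shows "comm_ring_hom (weight_vars w)"
proof
  show add: "weight_vars w (p + r) = weight_vars w p + weight_vars w r" for p r
    by (intro poly_mapping_eqI) (simp add: lookup_weight_vars lookup_add algebra_simps)
  show "weight_vars w 0 = 0"
    by (intro poly_mapping_eqI) (simp add: lookup_weight_vars)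
  show "weight_vars w 1 = 1"
    using weight_vars_single[of w 0 1] assms by simp
  show "weight_vars w (p * r) = weight_vars w p * weight_vars w r" for p r
    by (rule mvpoly_multI[OF add]) (simp add: mult_single weight_vars_single assms algebra_simps)
qed

lemma weight_vars_Const: "w 0 = 1 \<Longrightarrow> weight_vars w (Const a) = Const a"
  by (simp add: Const_def weight_vars_single)

lemma weight_vars_Var: "weight_vars w (Var i) = Const (w (Poly_Mapping.single i 1)) * Var i"
  by (simp add: Var_def Const_def weight_vars_single mult_single)

lemma mdeg_eq_sum:
  assumes "finite A" "Poly_Mapping.keys m \<subseteq> A"
  shows "mdeg m = (\<Sum>i\<in>A. Poly_Mapping.lookup m i)"
  unfolding mdeg_def using assms
  by (intro sum.mono_neutral_left) (auto simp: in_keys_iff)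

lemma mdeg_add: "mdeg (m + n) = mdeg m + mdeg n"
proof -
  let ?A = "Poly_Mapping.keys m \<union> Poly_Mapping.keys n"
  have "mdeg (m + n) = (\<Sum>i\<in>?A. Poly_Mapping.lookup (m + n) i)"
    by (intro mdeg_eq_sum) (auto simp: Poly_Mapping.keys_add)
  thus ?thesis by (simp add: lookup_add sum.distrib mdeg_eq_sum[of ?A])
qed

lemma mdeg_0 [simp]: "mdeg 0 = 0"
  by (simp add: mdeg_def)

lemma mdeg_single [simp]: "mdeg (Poly_Mapping.single i k) = k"
  by (simp add: mdeg_def)

lemma mdeg_map_key:
  assumes "bij \<pi>"
  shows "mdeg (Poly_Mapping.map_key \<pi> m) = mdeg m"
  unfolding mdeg_def
  by (rule sum.reindex_cong[OF inj_on_subset[OF bij_is_inj[OF bij_imp_bij_inv[OF assms]]]])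
     (use assms in \<open>auto simp: lookup_map_key bij_is_inj bij_is_surj surj_f_inv_f keys_map_key
        inj_imp_surj_inv intro!: image_eqI[of _ _ "\<pi> _"]\<close>)

definition scale_vars :: "complex \<Rightarrow> mvpoly \<Rightarrow> mvpoly" where
  "scale_vars c = weight_vars (\<lambda>m. c ^ mdeg m)"

lemma lookup_scale_vars: "Poly_Mapping.lookup (scale_vars c p) m = c ^ mdeg m * Poly_Mapping.lookup p m"
  by (simp add: scale_vars_def lookup_weight_vars)

lemma scale_vars_hom: "comm_ring_hom (scale_vars c)"
  unfolding scale_vars_def by (rule weight_vars_hom) (simp_all add: mdeg_add power_add)

lemma scale_vars_Const: "scale_vars c (Const a) = Const a"
  by (simp add: scale_vars_def weight_vars_Const)

lemma scale_vars_Var: "scale_vars c (Var i) = Const c * Var i"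
  by (simp add: scale_vars_def weight_vars_Var)

definition truncate_vars :: "nat \<Rightarrow> mvpoly \<Rightarrow> mvpoly" where
  "truncate_vars N = weight_vars (\<lambda>m. if Poly_Mapping.keys m \<subseteq> {..<N} then 1 else 0)"

lemma keys_add_nat: "Poly_Mapping.keys (m + n :: monomial) = Poly_Mapping.keys m \<union> Poly_Mapping.keys n"
  by (auto simp: in_keys_iff lookup_add)

lemma lookup_truncate_vars:
  "Poly_Mapping.lookup (truncate_vars N p) m =
     (if Poly_Mapping.keys m \<subseteq> {..<N} then Poly_Mapping.lookup p m else 0)"
  by (simp add: truncate_vars_def lookup_weight_vars)

lemma truncate_vars_hom: "comm_ring_hom (truncate_vars N)"
  unfolding truncate_vars_def by (rule weight_vars_hom) (auto simp: keys_add_nat)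

lemma truncate_vars_Const: "truncate_vars N (Const a) = Const a"
  by (simp add: truncate_vars_def weight_vars_Const)

lemma truncate_vars_Var: "truncate_vars N (Var i) = (if i < N then Var i else 0)"
  by (simp add: truncate_vars_def weight_vars_Var)

text \<open>The bound \<open>n\<close> is left free so that polynomials of different degrees can be
  expanded over a common range.\<close>

lemma poly_map_Const:
  assumes "Polynomial.degree f \<le> n"
  shows "poly (map_poly Const f) y = (\<Sum>k\<le>n. Const (poly.coeff f k) * y ^ k)"
proof -
  have "poly.coeff (map_poly Const f) = (\<lambda>k. Const (poly.coeff f k))"
    by (simp add: coeff_map_poly fun_eq_iff)
  moreover have "Polynomial.degree (map_poly Const f) \<le> n"
    using assms by (intro degree_le) (auto simp: coeff_map_poly coeff_eq_0)
  ultimately show ?thesis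
    using poly_as_sum_of_monoms'[of "map_poly Const f" n, symmetric]
    by (metis (no_types, lifting) poly_monom poly_sum sum.cong)
qed

subsection \<open>Determinants and quotients of alternants\<close>

abbreviation detn :: "nat \<Rightarrow> (nat \<Rightarrow> nat \<Rightarrow> 'a::comm_ring_1) \<Rightarrow> 'a" where
  "detn n a \<equiv> det (mat n n (\<lambda>(i, j). a i j))"

lemma detn_cong:
  assumes "\<And>i j. i < n \<Longrightarrow> j < n \<Longrightarrow> a i j = b i j"
  shows "detn n a = detn n b"
  using assms by (intro arg_cong[of _ _ det] eq_matI) auto

lemma permutes_lessThan_less: "p permutes {..<n} \<Longrightarrow> i < n \<Longrightarrow> p i < (n::nat)"
  using permutes_in_image[of p "{..<n}" i] by simp

lemma detn_def: "detn n a = (\<Sum>p | p permutes {..<n}. of_int (sign p) * (\<Prod>i<n. a i (p i)))"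
proof -
  have "detn n a = (\<Sum>p | p permutes {..<n}. of_int (sign p) *
      (\<Prod>i<n. mat n n (\<lambda>(i, j). a i j) $$ (i, p i)))"
    by (subst det_def'[of _ n]) (simp_all add: atLeast0LessThan)
  also have "\<dots> = (\<Sum>p | p permutes {..<n}. of_int (sign p) * (\<Prod>i<n. a i (p i)))"
    by (intro sum.cong refl arg_cong2[of _ _ _ _ "(*)"] prod.cong) (auto simp: permutes_lessThan_less)
  finally show ?thesis .
qed

lemma detn_transpose: "detn n (\<lambda>i j. a j i) = detn n a"
proof -
  have "mat n n (\<lambda>(i, j). a j i) = transpose_mat (mat n n (\<lambda>(i, j). a i j))"
    by (intro eq_matI) auto
  thus ?thesis using det_transpose[of "mat n n (\<lambda>(i, j). a i j)" n] by simp
qed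

lemma detn_scale:
  "detn n (\<lambda>i j. u i * v j * a i j) = (\<Prod>i<n. u i) * (\<Prod>j<n. v j) * detn n a"
proof -
  have "(\<Prod>i<n. u i * v (p i) * a i (p i)) = (\<Prod>i<n. u i) * (\<Prod>j<n. v j) * (\<Prod>i<n. a i (p i))"
    if "p permutes {..<n}" for p
    using prod.permute[OF that, of v] by (simp add: prod.distrib o_def)
  thus ?thesis
    unfolding detn_def sum_distrib_left by (intro sum.cong refl) (auto simp: mult_ac)
qed

lemma detn_permute_rows:
  assumes "p permutes {..<n}"
  shows "detn n (\<lambda>i j. a (p i) j) = of_int (sign p) * detn n a"
proof -
  have "detn n (\<lambda>i j. a (p i) j) = det (mat n n (\<lambda>(i, j). mat n n (\<lambda>(i, j). a i j) $$ (p i, j)))"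
    using assms by (intro arg_cong[of _ _ det] eq_matI) (auto simp: permutes_lessThan_less)
  thus ?thesis
    using det_permute_rows[of "mat n n (\<lambda>(i, j). a i j)" n p] assms by (simp add: atLeast0LessThan)
qed

lemma detn_permute_cols:
  assumes "p permutes {..<n}"
  shows "detn n (\<lambda>i j. a i (p j)) = of_int (sign p) * detn n a"
  using detn_permute_rows[OF assms, of "\<lambda>i j. a j i"]
  by (simp add: detn_transpose[of n a] detn_transpose[of n "\<lambda>i j. a i (p j)"])

lemma detn_mult: "detn n (\<lambda>i j. \<Sum>k<n. a i k * b k j) = detn n a * detn n b"
proof -
  have "mat n n (\<lambda>(i, j). \<Sum>k<n. a i k * b k j) = mat n n (\<lambda>(i, j). a i j) * mat n n (\<lambda>(i, j). b i j)"
    by (intro eq_matI) (auto simp: scalar_prod_def atLeast0LessThan)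
  thus ?thesis by (simp add: det_mult[of _ n])
qed

lemma detn_upper:
  assumes "\<And>i j. j < i \<Longrightarrow> i < n \<Longrightarrow> a i j = 0"
  shows "detn n a = (\<Prod>i<n. a i i)"
  using assms by (subst det_upper_triangular[of _ n])
    (auto simp: prod_list_diag_prod atLeast0LessThan)

lemma detn_lower:
  assumes "\<And>i j. i < j \<Longrightarrow> j < n \<Longrightarrow> a i j = 0"
  shows "detn n a = (\<Prod>i<n. a i i)"
  using assms by (subst detn_transpose[symmetric], subst detn_upper) auto

lemma detn_Suc_last_row:
  assumes "\<And>j. j < n \<Longrightarrow> a n j = 0"
  shows "detn (Suc n) a = a n n * detn n a"
proof -
  let ?A = "mat (Suc n) (Suc n) (\<lambda>(i, j). a i j)"
  have "mat_delete ?A n n = mat n n (\<lambda>(i, j). a i j)"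
    by (intro eq_matI) (auto simp: mat_delete_def)
  hence "cofactor ?A n n = detn n a"
    by (simp add: cofactor_def flip: power_mult_distrib)
  moreover have "det ?A = (\<Sum>j<Suc n. ?A $$ (n, j) * cofactor ?A n j)"
    by (rule laplace_expansion_row) auto
  ultimately show ?thesis using assms by simp
qed

lemma detn_Suc_last_col:
  assumes "\<And>i. i < n \<Longrightarrow> a i n = 0"
  shows "detn (Suc n) a = a n n * detn n a"
  using detn_Suc_last_row[of n "\<lambda>i j. a j i"] assms
  by (simp add: detn_transpose[of n a] detn_transpose[of "Suc n" a])

lemma detn_hom: "comm_ring_hom T \<Longrightarrow> T (detn n a) = detn n (\<lambda>i j. T (a i j))"
proof -
  assume "comm_ring_hom T"
  then interpret comm_ring_hom T .
  have "map_mat T (mat n n (\<lambda>(i, j). a i j)) = mat n n (\<lambda>(i, j). T (a i j))"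
    by (intro eq_matI) auto
  thus ?thesis using hom_det by metis
qed

text \<open>The trailing rows vanish left of a unit diagonal, so expansion along the last row peels
  them off one at a time. This is how determinants growing with the number of variables become
  determinants of fixed size.\<close>

lemma detn_reduce:
  assumes "l \<le> n" and "\<And>i j. l \<le> i \<Longrightarrow> i < n \<Longrightarrow> j < i \<Longrightarrow> a i j = 0"
    and "\<And>i. l \<le> i \<Longrightarrow> i < n \<Longrightarrow> a i i = 1"
  shows "detn n a = detn l a"
  using assms
proof (induction n rule: dec_induct)
  case base thus ?case by simp
next
  case (step n)
  have "detn (Suc n) a = a n n * detn n a"
    using step by (intro detn_Suc_last_row) auto
  thus ?case using step by simp
qed

text \<open>
  The nodes are taken from the top so that the matrix of basis values is lower triangular with
  diagonal product exactly \<open>V\<close>, including the sign.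
\<close>

lemma newton_interpolation:
  fixes x :: "nat \<Rightarrow> 'a::comm_ring_1"
  shows "\<exists>r. \<forall>j<N. poly f (x j) = (\<Sum>k<N. r k * (\<Prod>t\<in>{k<..<N}. x j - x t))"
proof (induction N arbitrary: f)
  case 0 thus ?case by simp
next
  case (Suc N)
  define g where "g = synthetic_div f (x N)"
  from Suc obtain r where r: "\<forall>j<N. poly g (x j) = (\<Sum>k<N. r k * (\<Prod>t\<in>{k<..<N}. x j - x t))"
    by blast
  have f: "poly f y = (y - x N) * poly g y + poly f (x N)" for y
    using arg_cong[OF synthetic_div_correct'[of "x N" f], of "\<lambda>p. poly p y"]
    by (simp add: g_def algebra_simps)
  have eq: "{k<..<Suc N} = insert N {k<..<N}" if "k < N" for k
    using that by auto
  have sum: "(\<Sum>k<Suc N. (r(N := poly f (x N))) k * (\<Prod>t\<in>{k<..<Suc N}. y - x t)) =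
    (y - x N) * (\<Sum>k<N. r k * (\<Prod>t\<in>{k<..<N}. y - x t)) + poly f (x N)" for y
  proof -
    have "{N<..<Suc N} = {}" by auto
    thus ?thesis by (simp add: sum_distrib_left eq mult_ac)
  qed
  show ?case
  proof (intro exI[of _ "r(N := poly f (x N))"] allI impI)
    fix j assume "j < Suc N"
    \<comment> \<open>At \<open>j = N\<close> the factor \<open>x j - x N\<close> is zero and only
      the remainder \<open>poly f (x N)\<close> is left; the induction hypothesis serves the other
      indices.\<close>
    thus "poly f (x j) = (\<Sum>k<Suc N. (r(N := poly f (x N))) k * (\<Prod>t\<in>{k<..<Suc N}. x j - x t))"
      using r unfolding sum by (cases "j = N") (auto simp: f[of "x j"])
  qed
qed

lemma detn_newton:
  fixes x :: "nat \<Rightarrow> 'a::comm_ring_1"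
  shows "detn N (\<lambda>k j. \<Prod>t\<in>{k<..<N}. x j - x t) = (\<Prod>k<N. \<Prod>t\<in>{k<..<N}. x k - x t)"
  by (rule detn_lower) (auto intro!: prod_zero)

text \<open>Newton interpolation factors the matrix of values into a coefficient matrix and the
  triangular Newton matrix, so the quotient is the determinant of the coefficients. It provides the
  existence half of the definite description in \<open>det_quotient\<close>.\<close>

lemma detn_poly_dvd:
  fixes x :: "nat \<Rightarrow> 'a::comm_ring_1"
  shows "\<exists>p. p * (\<Prod>k<N. \<Prod>t\<in>{k<..<N}. x k - x t) = detn N (\<lambda>i j. poly (f i) (x j))"
proof -
  have "\<forall>i. \<exists>r. \<forall>j<N. poly (f i) (x j) = (\<Sum>k<N. r k * (\<Prod>t\<in>{k<..<N}. x j - x t))"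
    using newton_interpolation by blast
  then obtain r where r: "\<forall>i. \<forall>j<N. poly (f i) (x j) = (\<Sum>k<N. r i k * (\<Prod>t\<in>{k<..<N}. x j - x t))"
    by metis
  have "detn N (\<lambda>i j. poly (f i) (x j)) =
     detn N (\<lambda>i j. \<Sum>k<N. r i k * (\<Prod>t\<in>{k<..<N}. x j - x t))"
    using r by (intro detn_cong) auto
  also have "\<dots> = detn N r * (\<Prod>k<N. \<Prod>t\<in>{k<..<N}. x k - x t)"
    by (simp only: detn_mult detn_newton)
  finally have "detn N r * (\<Prod>k<N. \<Prod>t\<in>{k<..<N}. x k - x t) = detn N (\<lambda>i j. poly (f i) (x j))"
    by (rule sym)
  thus ?thesis by (rule exI)
qed

lemma poly_eq_sum_reversed:
  fixes b :: "'a::comm_ring_1 poly"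
  assumes "Polynomial.degree b < N"
  shows "poly b y = (\<Sum>i<N. poly.coeff b (N - 1 - i) * y ^ (N - 1 - i))"
proof -
  have "poly b y = (\<Sum>i<N. poly.coeff b i * y ^ i)"
    unfolding poly_altdef using assms
    by (intro sum.mono_neutral_left) (auto simp: coeff_eq_0)
  also have "\<dots> = (\<Sum>i<N. poly.coeff b (N - 1 - i) * y ^ (N - 1 - i))"
    by (subst sum.nat_diff_reindex[symmetric]) simp
  finally show ?thesis .
qed

text \<open>The monic Newton polynomials \<open>b k\<close> differ from the descending powers by a
  unitriangular change of basis, so both bases give the same determinant, including its
  sign.\<close>

lemma detn_vandermonde:
  fixes x :: "nat \<Rightarrow> 'a::idom"
  shows "detn N (\<lambda>i j. x j ^ (N - 1 - i)) = (\<Prod>k<N. \<Prod>t\<in>{k<..<N}. x k - x t)"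
proof -
  define b where "b k = (\<Prod>t\<in>{k<..<N}. [:- x t, 1:])" for k
  have deg: "Polynomial.degree (b k) = N - 1 - k" for k
    unfolding b_def by (subst degree_prod_eq_sum_degree) auto
  have lead: "lead_coeff (b k) = 1" for k
    unfolding b_def by (subst lead_coeff_prod) simp
  have p: "poly (b k) y = (\<Prod>t\<in>{k<..<N}. y - x t)" for k y
    unfolding b_def poly_prod by (intro prod.cong) auto
  have "(\<Prod>k<N. \<Prod>t\<in>{k<..<N}. x k - x t) = detn N (\<lambda>k j. poly (b k) (x j))"
    by (simp add: p detn_newton)
  also have "\<dots> = detn N (\<lambda>k j. \<Sum>i<N. poly.coeff (b k) (N - 1 - i) * x j ^ (N - 1 - i))"
    by (intro detn_cong poly_eq_sum_reversed) (auto simp: deg)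
  also have "\<dots> = detn N (\<lambda>k i. poly.coeff (b k) (N - 1 - i)) * detn N (\<lambda>i j. x j ^ (N - 1 - i))"
    by (rule detn_mult)
  also have "detn N (\<lambda>k i. poly.coeff (b k) (N - 1 - i)) = (\<Prod>k<N. poly.coeff (b k) (N - 1 - k))"
    by (rule detn_upper) (auto intro!: coeff_eq_0 simp: deg)
  also have "\<dots> = 1"
    using lead by (auto simp: deg intro!: prod.neutral)
  finally show ?thesis by simp
qed

section \<open>Alternants, their symmetry and their quotients by the Vandermonde product\<close>

lemma vandermonde_altdef: "vandermonde N = (\<Prod>k<N. \<Prod>t\<in>{k<..<N}. Var k - Var t)"
proof -
  have "{(i, j). i < j \<and> j < N} = Sigma {..<N} (\<lambda>i. {i<..<N})" by auto
  thus ?thesis by (simp add: vandermonde_def prod.Sigma)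
qed

lemma vandermonde_det: "vandermonde N = detn N (\<lambda>i j. Var j ^ (N - 1 - i))"
  unfolding vandermonde_altdef by (rule detn_vandermonde[symmetric])

lemma vandermonde_nonzero: "vandermonde N \<noteq> 0"
  by (auto simp: vandermonde_altdef)

definition alternant :: "nat \<Rightarrow> (nat \<Rightarrow> complex poly) \<Rightarrow> (nat \<Rightarrow> nat) \<Rightarrow> mvpoly" where
  "alternant N f lam = detn N (\<lambda>i j. subst_var (f (lam i + N - 1 - i)) j)"

lemma det_quotient_unique: "p * vandermonde N = alternant N f lam \<Longrightarrow> det_quotient N f lam = p"
  unfolding det_quotient_def alternant_def[symmetric]
  by (intro the_equality) (assumption, metis mult_right_cancel vandermonde_nonzero)

lemma det_quotient_vandermonde: "det_quotient N f lam * vandermonde N = alternant N f lam"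
proof -
  obtain p where "p * vandermonde N = alternant N f lam"
    unfolding vandermonde_altdef alternant_def subst_var_def
    using detn_poly_dvd[where N = N and x = Var and f = "\<lambda>i. map_poly Const (f (lam i + N - 1 - i))"] by blast
  thus ?thesis using det_quotient_unique by metis
qed

lemma subst_var_hom:
  assumes "comm_ring_hom T" "\<And>a. T (Const a) = Const a"
  shows "T (subst_var f j) = poly (map_poly Const f) (T (Var j))"
proof -
  interpret comm_ring_hom T by fact
  show ?thesis
    by (simp add: subst_var_def poly_map_Const[OF order.refl] hom_sum hom_mult hom_power assms(2))
qed

lemma subst_var_monom: "subst_var (monom a k) j = Const a * Var j ^ k"
  by (simp add: subst_var_def map_poly_monom poly_monom)

lemma vandermonde_alternant: "vandermonde N = alternant N (monom 1) (\<lambda>_. 0)"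
  by (simp add: vandermonde_det alternant_def subst_var_monom)

lemma perm_vars_alternant:
  assumes "\<pi> permutes {..<N}"
  shows "perm_vars \<pi> (alternant N f lam) = of_int (sign \<pi>) * alternant N f lam"
proof -
  have bij: "bij \<pi>" using assms by (rule permutes_bij)
  show ?thesis
    unfolding alternant_def detn_hom[OF perm_vars_hom[OF bij]]
    by (subst detn_permute_cols[OF assms, symmetric])
       (simp add: subst_var_hom[OF perm_vars_hom[OF bij]] perm_vars_Const bij perm_vars_Var,
        simp add: subst_var_def)
qed

text \<open>\<open>V\<close> is itself an alternant, that of the monomials at the empty partition,
  so numerator and denominator change by the same sign.\<close>

lemma perm_vars_det_quotient:
  assumes "\<pi> permutes {..<N}"
  shows "perm_vars \<pi> (det_quotient N f lam) = det_quotient N f lam"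
proof -
  have bij: "bij \<pi>" using assms by (rule permutes_bij)
  interpret comm_ring_hom "perm_vars \<pi>" by (rule perm_vars_hom[OF bij])
  have "perm_vars \<pi> (det_quotient N f lam) * perm_vars \<pi> (vandermonde N) = perm_vars \<pi> (alternant N f lam)"
    by (simp flip: det_quotient_vandermonde hom_mult)
  hence "of_int (sign \<pi>) * (perm_vars \<pi> (det_quotient N f lam) * vandermonde N) = of_int (sign \<pi>) * alternant N f lam"
    by (simp add: perm_vars_alternant[OF assms] vandermonde_alternant mult_ac)
  moreover have "of_int (sign \<pi>) \<noteq> (0 :: mvpoly)"
    by (cases \<pi> rule: sign_cases) auto
  ultimately have "perm_vars \<pi> (det_quotient N f lam) * vandermonde N = alternant N f lam"
    by (metis mult_left_cancel)
  thus ?thesis by (metis det_quotient_unique)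
qed

lemma truncate_vars_alternant: "truncate_vars N (alternant N f lam) = alternant N f lam"
  unfolding alternant_def detn_hom[OF truncate_vars_hom]
  by (rule detn_cong)
     (simp add: subst_var_hom[OF truncate_vars_hom] truncate_vars_Const truncate_vars_Var,
      simp add: subst_var_def)

lemma truncate_vars_det_quotient: "truncate_vars N (det_quotient N f lam) = det_quotient N f lam"
proof -
  interpret comm_ring_hom "truncate_vars N" by (rule truncate_vars_hom)
  have "truncate_vars N (det_quotient N f lam) * vandermonde N = alternant N f lam"
    by (metis hom_mult det_quotient_vandermonde truncate_vars_alternant vandermonde_alternant)
  thus ?thesis by (metis det_quotient_unique)
qed

lemma det_quotient_SymN: "det_quotient N f lam \<in> SymN N"
proof -
  have "Poly_Mapping.keys m \<subseteq> {..<N}" if "m \<in> Poly_Mapping.keys (det_quotient N f lam)" for m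
    using that truncate_vars_det_quotient[of N f lam]
    by (metis in_keys_iff lookup_truncate_vars)
  moreover have "Poly_Mapping.lookup (det_quotient N f lam) (Poly_Mapping.map_key \<pi> m) =
      Poly_Mapping.lookup (det_quotient N f lam) m" if "\<pi> permutes {..<N}" for \<pi> m
    using perm_vars_det_quotient[OF that, of f lam] lookup_perm_vars[OF permutes_bij[OF that]] by metis
  ultimately show ?thesis by (simp add: SymN_def)
qed

lemma scale_vars_alternant:
  assumes "\<And>k. pcompose (f k) [:0, c:] = smult (c ^ k) (g k)"
  shows "scale_vars c (alternant N f lam) = Const (\<Prod>i<N. c ^ (lam i + N - 1 - i)) * alternant N g lam"
proof -
  have "poly (map_poly Const (f k)) (Const c * Var j) = Const (c ^ k) * subst_var (g k) j" for k j
  proof -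
    have "poly.coeff (f k) i * c ^ i = c ^ k * poly.coeff (g k) i" for i
      using arg_cong[OF assms[of k], of "\<lambda>p. poly.coeff p i"] by (simp add: coeff_pcompose_linear mult_ac)
    hence *: "Const (poly.coeff (f k) i) * (Const c * Var j) ^ i =
        Const (c ^ k) * (Const (poly.coeff (g k) i) * Var j ^ i)" for i
      by (metis (no_types, lifting) Const_mult Const_power mult.assoc power_mult_distrib)
    define n where "n = max (Polynomial.degree (f k)) (Polynomial.degree (g k))"
    have "poly (map_poly Const (f k)) (Const c * Var j) =
        (\<Sum>i\<le>n. Const (poly.coeff (f k) i) * (Const c * Var j) ^ i)"
      by (rule poly_map_Const) (simp add: n_def)
    also have "\<dots> = Const (c ^ k) * (\<Sum>i\<le>n. Const (poly.coeff (g k) i) * Var j ^ i)"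
      by (simp add: * sum_distrib_left)
    also have "\<dots> = Const (c ^ k) * subst_var (g k) j"
      by (simp add: subst_var_def poly_map_Const[of _ n] n_def)
    finally show ?thesis .
  qed
  thus ?thesis
    unfolding alternant_def detn_hom[OF scale_vars_hom]
    using detn_scale[of N "\<lambda>i. Const (c ^ (lam i + N - 1 - i))" "\<lambda>_. 1"
       "\<lambda>i j. subst_var (g (lam i + N - 1 - i)) j"]
    by (simp add: subst_var_hom[OF scale_vars_hom] scale_vars_Const scale_vars_Var Const_hom.hom_prod)
qed

text \<open>The hypothesis says \<open>f_k(c x) = c^k g_k(x)\<close>, so each row of the alternant
  yields \<open>c^(lam i)\<close> times \<open>c^(N-1-i)\<close>. The second factors are what
  \<open>V\<close> contributes under the same scaling, and they cancel.\<close>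

lemma scale_vars_det_quotient:
  assumes "\<And>k. pcompose (f k) [:0, c:] = smult (c ^ k) (g k)" "c \<noteq> 0"
  shows "scale_vars c (det_quotient N f lam) = Const (\<Prod>i<N. c ^ lam i) * det_quotient N g lam"
proof -
  interpret comm_ring_hom "scale_vars c" by (rule scale_vars_hom)
  let ?C = "\<Prod>i<N. c ^ (N - 1 - i)"
  have V: "scale_vars c (vandermonde N) = Const ?C * vandermonde N"
    using scale_vars_alternant[of "monom 1" c "monom 1" N "\<lambda>_. 0"]
    by (simp add: vandermonde_alternant poly_eq_iff coeff_pcompose_linear coeff_monom)
  have "(\<Prod>i<N. c ^ (lam i + N - 1 - i)) = (\<Prod>i<N. c ^ lam i) * ?C"
    by (subst prod.distrib[symmetric]) (intro prod.cong refl, simp flip: power_add)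
  hence "Const ?C * (scale_vars c (det_quotient N f lam) * vandermonde N) =
      Const ?C * (Const (\<Prod>i<N. c ^ lam i) * det_quotient N g lam * vandermonde N)"
    using scale_vars_alternant[OF assms(1), of N lam] V
    by (simp add: hom_mult Const_mult mult_ac flip: det_quotient_vandermonde[of N])
  moreover have "Const ?C \<noteq> 0"
    using assms(2) by (simp flip: Const_hom.hom_zero)
  ultimately have "scale_vars c (det_quotient N f lam) * vandermonde N =
      Const (\<Prod>i<N. c ^ lam i) * det_quotient N g lam * vandermonde N"
    by (metis mult_left_cancel)
  thus ?thesis using vandermonde_nonzero by (metis mult_right_cancel)
qed

section \<open>Schur polynomials: homogeneity and stability\<close>

abbreviation schur :: "nat \<Rightarrow> (nat \<Rightarrow> nat) \<Rightarrow> mvpoly" where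
  "schur N lam \<equiv> det_quotient N (monom 1) lam"

text \<open>Doubling all variables multiplies the coefficient at \<open>m\<close> by
  \<open>2 ^ mdeg m\<close> and the whole polynomial by one fixed power of 2. Distinct powers of 2
  are different, so only one degree occurs.\<close>

lemma schur_homogeneous:
  assumes "Poly_Mapping.lookup (schur N lam) m \<noteq> 0"
  shows "mdeg m = (\<Sum>i<N. lam i)"
proof -
  have "pcompose (monom 1 k) [:0, 2::complex:] = smult (2 ^ k) (monom 1 k)" for k
    by (simp add: poly_eq_iff coeff_pcompose_linear coeff_monom)
  from scale_vars_det_quotient[OF this, of N lam]
  have "Poly_Mapping.lookup (scale_vars 2 (schur N lam)) m =
      Poly_Mapping.lookup (Const (\<Prod>i<N. 2 ^ lam i) * schur N lam) m" by simp
  hence "(2::complex) ^ mdeg m = 2 ^ (\<Sum>i<N. lam i)"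
    using assms by (simp add: lookup_scale_vars Const_mult_lookup power_sum)
  hence "of_nat (2 ^ mdeg m) = (of_nat (2 ^ (\<Sum>i<N. lam i)) :: complex)"
    by simp
  thus ?thesis unfolding of_nat_eq_iff by simp
qed

lemma truncate_vars_alternant_Suc:
  assumes "lam N = 0"
  shows "truncate_vars N (alternant (Suc N) (monom 1) lam) = (\<Prod>j<N. Var j) * alternant N (monom 1) lam"
proof -
  interpret comm_ring_hom "truncate_vars N" by (rule truncate_vars_hom)
  have "truncate_vars N (alternant (Suc N) (monom 1) lam) =
     detn (Suc N) (\<lambda>i j. (if j < N then Var j else 0) ^ (lam i + N - i))"
    by (simp add: alternant_def detn_hom[OF truncate_vars_hom] subst_var_monom truncate_vars_Var hom_power)
  also have "\<dots> = detn N (\<lambda>i j. (if j < N then Var j else 0) ^ (lam i + N - i))"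
    by (subst detn_Suc_last_col) (simp_all add: assms)
  also have "\<dots> = detn N (\<lambda>i j. 1 * Var j * Var j ^ (lam i + N - 1 - i))"
    by (rule detn_cong) (simp flip: power_Suc add: Suc_diff_Suc)
  also have "\<dots> = (\<Prod>j<N. Var j) * alternant N (monom 1) lam"
    by (subst detn_scale) (simp add: alternant_def subst_var_monom)
  finally show ?thesis .
qed

text \<open>The alternant identity is used for \<open>lam\<close> and for the empty partition; the
  common monomial factor cancels in the quotient.\<close>

lemma truncate_vars_schur_Suc:
  assumes "lam N = 0"
  shows "truncate_vars N (schur (Suc N) lam) = schur N lam"
proof -
  interpret comm_ring_hom "truncate_vars N" by (rule truncate_vars_hom)
  have "truncate_vars N (schur (Suc N) lam) * ((\<Prod>j<N. Var j) * vandermonde N) =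
     (\<Prod>j<N. Var j) * alternant N (monom 1) lam"
    using truncate_vars_alternant_Suc[of lam N] truncate_vars_alternant_Suc[of "\<lambda>_. 0" N] assms
    by (metis vandermonde_alternant det_quotient_vandermonde hom_mult)
  hence "(\<Prod>j<N. Var j) * (truncate_vars N (schur (Suc N) lam) * vandermonde N) =
     (\<Prod>j<N. Var j) * alternant N (monom 1) lam"
    by (simp add: mult_ac)
  moreover have "Var j \<noteq> 0" for j
    by (metis Var_def lookup_single_eq lookup_zero one_neq_zero)
  hence "(\<Prod>j<N. Var j) \<noteq> 0" by simp
  ultimately have "truncate_vars N (schur (Suc N) lam) * vandermonde N = alternant N (monom 1) lam"
    by (metis mult_left_cancel)
  thus ?thesis by (metis det_quotient_unique)
qed

lemma lookup_schur_stable: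
  assumes "\<And>i. n \<le> i \<Longrightarrow> lam i = 0" "Poly_Mapping.keys m \<subseteq> {..<n}" "n \<le> N"
  shows "Poly_Mapping.lookup (schur N lam) m = Poly_Mapping.lookup (schur n lam) m"
  using assms(3)
proof (induction N rule: dec_induct)
  case (step N)
  have "Poly_Mapping.keys m \<subseteq> {..<N}" using assms(2) step by auto
  thus ?case
    using truncate_vars_schur_Suc[of lam N] assms(1)[of N] step lookup_truncate_vars[of N _ m] by metis
qed simp

subsection \<open>Convergence of symmetric polynomials is coefficientwise\<close>

text \<open>\<open>SymN\<close> offers invariance under permutations of \<open>{..<N}\<close>,
  \<open>Sym_le\<close> demands it for all bijections. On a finite set that stays inside
  \<open>{..<N}\<close>, a bijection can be replaced by a permutation: the two complements in
  \<open>{..<N}\<close> have equal size.\<close>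

lemma extend_to_permutation:
  fixes \<sigma> :: "nat \<Rightarrow> nat"
  assumes "bij \<sigma>" "A \<subseteq> {..<N}" "\<sigma> ` A \<subseteq> {..<N}"
  obtains \<rho> where "\<rho> permutes {..<N}" "\<And>i. i \<in> A \<Longrightarrow> \<rho> i = \<sigma> i"
proof -
  have inj: "inj_on \<sigma> A" using assms(1) by (meson bij_is_inj inj_on_subset subset_UNIV)
  have fin: "finite A" using assms(2) finite_subset by blast
  have "card ({..<N} - A) = card ({..<N} - \<sigma> ` A)"
    using assms fin inj by (simp add: card_Diff_subset card_image)
  then obtain h where h: "bij_betw h ({..<N} - A) ({..<N} - \<sigma> ` A)"
    using finite_same_card_bij[of "{..<N} - A" "{..<N} - \<sigma> ` A"] by auto
  define \<rho> where "\<rho> i = (if i \<in> A then \<sigma> i else if i < N then h i else i)" for i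
  have "bij_betw \<rho> A (\<sigma> ` A)"
    using inj by (simp add: bij_betw_def \<rho>_def inj_on_def)
  moreover have "bij_betw \<rho> ({..<N} - A) ({..<N} - \<sigma> ` A)"
    using h by (rule bij_betw_cong[THEN iffD1, rotated]) (auto simp: \<rho>_def)
  ultimately have "bij_betw \<rho> (A \<union> ({..<N} - A)) (\<sigma> ` A \<union> ({..<N} - \<sigma> ` A))"
    by (rule bij_betw_combine) auto
  hence "bij_betw \<rho> {..<N} {..<N}"
    using assms by (simp add: Un_absorb1)
  hence "\<rho> permutes {..<N}"
    by (rule bij_imp_permutes) (use assms in \<open>auto simp: \<rho>_def\<close>)
  thus ?thesis using that by (auto simp: \<rho>_def)
qed

lemma SymN_lookup_map_key:
  assumes "p \<in> SymN N" "bij \<sigma>"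
    and "Poly_Mapping.keys m \<subseteq> {..<N}" "Poly_Mapping.keys (Poly_Mapping.map_key \<sigma> m) \<subseteq> {..<N}"
  shows "Poly_Mapping.lookup p (Poly_Mapping.map_key \<sigma> m) = Poly_Mapping.lookup p m"
proof -
  let ?A = "Poly_Mapping.keys (Poly_Mapping.map_key \<sigma> m)"
  have A: "?A = \<sigma> -` Poly_Mapping.keys m"
    using assms(2) by (simp add: keys_map_key bij_is_inj)
  have im: "\<sigma> ` ?A = Poly_Mapping.keys m"
    unfolding A using assms(2) by (simp add: bij_is_surj)
  obtain \<rho> where \<rho>: "\<rho> permutes {..<N}" "\<And>i. i \<in> ?A \<Longrightarrow> \<rho> i = \<sigma> i"
    using extend_to_permutation[of \<sigma> ?A N] assms im by auto
  have "Poly_Mapping.map_key \<rho> m = Poly_Mapping.map_key \<sigma> m"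
  proof (rule poly_mapping_eqI)
    fix i
    show "Poly_Mapping.lookup (Poly_Mapping.map_key \<rho> m) i = Poly_Mapping.lookup (Poly_Mapping.map_key \<sigma> m) i"
    proof (cases "i \<in> ?A")
      case True
      thus ?thesis using \<rho> assms(2) by (simp add: lookup_map_key bij_is_inj permutes_inj)
    next
      case False
      have "\<rho> i \<notin> Poly_Mapping.keys m"
      proof
        assume "\<rho> i \<in> Poly_Mapping.keys m"
        then obtain j where "j \<in> ?A" "\<rho> i = \<sigma> j" using im by blast
        hence "\<rho> i = \<rho> j" using \<rho>(2) by simp
        thus False using False \<open>j \<in> ?A\<close> permutes_inj[OF \<rho>(1)] by (metis injD)
      qed
      thus ?thesis using False \<rho> assms(2)
        by (simp add: lookup_map_key bij_is_inj permutes_inj in_keys_iff)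
    qed
  qed
  moreover have "Poly_Mapping.lookup p (Poly_Mapping.map_key \<rho> m) = Poly_Mapping.lookup p m"
    using assms(1) \<rho>(1) unfolding SymN_def by blast
  ultimately show ?thesis by simp
qed

lemma map_key_comp:
  assumes "bij \<sigma>" "bij \<tau>"
  shows "Poly_Mapping.map_key \<sigma> (Poly_Mapping.map_key \<tau> m) = Poly_Mapping.map_key (\<tau> \<circ> \<sigma>) m"
  using assms by (intro poly_mapping_eqI) (simp add: lookup_map_key bij_is_inj bij_comp inj_compose)

text \<open>
  The symmetric extension of \<open>p\<close> takes at a monomial the value of \<open>p\<close> at any monomial of its orbit
  that only involves the first \<open>N\<close> variables.
\<close>

lemma restrict_vars_surj:
  assumes "p \<in> SymN_le d N"
  obtains F where "F \<in> Sym_le d" "restrict_vars N F = p"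
proof -
  have p: "p \<in> SymN N" "\<And>m. Poly_Mapping.lookup p m \<noteq> 0 \<Longrightarrow> mdeg m \<le> d"
    using assms by (auto simp: SymN_le_def in_keys_iff)
  define P where "P m \<sigma> \<longleftrightarrow> bij \<sigma> \<and> Poly_Mapping.keys (Poly_Mapping.map_key \<sigma> m) \<subseteq> {..<N}" for m :: monomial and \<sigma>
  define F where "F m = (if \<exists>\<sigma>. P m \<sigma> then Poly_Mapping.lookup p (Poly_Mapping.map_key (Eps (P m)) m) else 0)" for m
  have F_eq: "F m = Poly_Mapping.lookup p (Poly_Mapping.map_key \<sigma> m)" if "P m \<sigma>" for m \<sigma>
  proof -
    \<comment> \<open>The value must not depend on the choice made by \<open>Eps\<close>: two
      admissible rearrangements of \<open>m\<close> are related by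
      \<open>inv_into UNIV \<tau> \<circ> \<sigma>\<close>, under which the coefficients of
      \<open>p\<close> are invariant.\<close>
    define \<tau> where "\<tau> = Eps (P m)"
    have \<tau>: "P m \<tau>" unfolding \<tau>_def using that by (rule someI[of "P m"])
    have bij: "bij \<sigma>" "bij \<tau>" using that \<tau> by (auto simp: P_def)
    have eq: "Poly_Mapping.map_key \<sigma> m =
        Poly_Mapping.map_key (inv_into UNIV \<tau> \<circ> \<sigma>) (Poly_Mapping.map_key \<tau> m)"
      using bij by (simp add: map_key_comp bij_comp bij_imp_bij_inv o_assoc surj_iff[THEN iffD1] bij_is_surj)
    have "Poly_Mapping.lookup p (Poly_Mapping.map_key \<sigma> m) = Poly_Mapping.lookup p (Poly_Mapping.map_key \<tau> m)"
      unfolding eq using that \<tau> bij unfolding P_def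
      by (intro SymN_lookup_map_key[OF p(1)]) (auto simp: bij_comp bij_imp_bij_inv simp flip: eq)
    thus ?thesis using that by (auto simp: F_def \<tau>_def)
  qed
  have "F m = 0" if "mdeg m > d" for m
    using that p(2) mdeg_map_key[of "Eps (P m)" m] someI_ex[of "P m"]
    by (fastforce simp: F_def P_def)
  moreover have "F (Poly_Mapping.map_key \<tau> m) = F m" if "bij \<tau>" for \<tau> m
  proof (cases "\<exists>\<sigma>. P (Poly_Mapping.map_key \<tau> m) \<sigma>")
    case True
    then obtain \<sigma> where \<sigma>: "P (Poly_Mapping.map_key \<tau> m) \<sigma>" by blast
    hence "P m (\<tau> \<circ> \<sigma>)" using that by (metis P_def map_key_comp bij_comp)
    thus ?thesis using F_eq[OF \<sigma>] F_eq[of m "\<tau> \<circ> \<sigma>"] \<sigma> that by (simp add: P_def map_key_comp)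
  next
    case False
    have "\<not> P m \<sigma>" for \<sigma>
    proof
      assume "P m \<sigma>"
      hence "P (Poly_Mapping.map_key \<tau> m) (inv_into UNIV \<tau> \<circ> \<sigma>)"
        using that by (simp add: P_def map_key_comp bij_comp bij_imp_bij_inv o_assoc surj_iff[THEN iffD1] bij_is_surj)
      thus False using False by blast
    qed
    thus ?thesis using False by (simp add: F_def)
  qed
  ultimately have "F \<in> Sym_le d" by (auto simp: Sym_le_def not_le[symmetric])
  moreover have "restrict_vars N F = p"
  proof -
    have "(if Poly_Mapping.keys m \<subseteq> {..<N} then F m else 0) = Poly_Mapping.lookup p m" for m
    proof (cases "Poly_Mapping.keys m \<subseteq> {..<N}")
      case True
      have "Poly_Mapping.map_key id m = m"
        by (intro poly_mapping_eqI) (simp add: lookup_map_key)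
      thus ?thesis using F_eq[of m id] True by (simp add: P_def)
    next
      case False
      thus ?thesis using p(1) by (auto simp: SymN_def in_keys_iff)
    qed
    thus ?thesis by (simp add: restrict_vars_def)
  qed
  ultimately show ?thesis using that by blast
qed

text \<open>This provides the finite support that \<open>Abs_poly_mapping\<close> requires in
  \<open>restrict_vars\<close>.\<close>

lemma finite_monomials:
  "finite {m :: monomial. Poly_Mapping.keys m \<subseteq> {..<N} \<and> mdeg m \<le> d}" (is "finite ?A")
proof -
  have "inj_on Poly_Mapping.lookup ?A"
    by (intro inj_onI poly_mapping_eqI) simp
  moreover have "Poly_Mapping.lookup ` ?A \<subseteq> {f. \<forall>i. (i \<in> {..<N} \<longrightarrow> f i \<in> {..d}) \<and> (i \<notin> {..<N} \<longrightarrow> f i = 0)}"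
  proof -
    have le: "Poly_Mapping.lookup m i \<le> mdeg m" for m :: monomial and i
      by (cases "i \<in> Poly_Mapping.keys m") (auto simp: mdeg_def in_keys_iff intro: member_le_sum)
    show ?thesis
    proof (intro image_subsetI CollectI conjI allI impI)
      fix m i assume "m \<in> ?A"
      thus "Poly_Mapping.lookup m i \<in> {..d}"
        using le[of m i] by simp
    next
      fix m i assume "m \<in> ?A" "i \<notin> {..<N}"
      thus "Poly_Mapping.lookup m i = 0"
        unfolding not_in_keys_iff_lookup_eq_zero[symmetric] by blast
    qed
  qed
  ultimately show ?thesis
    using finite_set_of_finite_funs[of "{..<N}" "{..d}" "0::nat"]
    by (meson finite_atMost finite_imageD finite_lessThan finite_subset)
qed

lemma lookup_restrict_vars:
  assumes "F \<in> Sym_le d"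
  shows "Poly_Mapping.lookup (restrict_vars N F) m = (if Poly_Mapping.keys m \<subseteq> {..<N} then F m else 0)"
proof -
  have "{m. (if Poly_Mapping.keys m \<subseteq> {..<N} then F m else 0) \<noteq> 0} \<subseteq>
      {m. Poly_Mapping.keys m \<subseteq> {..<N} \<and> mdeg m \<le> d}"
    using assms by (auto simp: Sym_le_def split: if_splits)
  thus ?thesis
    unfolding restrict_vars_def using finite_subset[OF _ finite_monomials]
    by (subst lookup_Abs_poly_mapping) blast+
qed

text \<open>Every preimage of \<open>p\<close> under restriction carries the coefficients of
  \<open>p\<close> on the monomials in the first \<open>N\<close> variables, so the choice made by
  \<open>inv_into\<close> is invisible there. For growing \<open>N\<close> these monomials exhaust
  all.\<close>

lemma sym_iota_eq:
  assumes "p \<in> SymN_le d N" "Poly_Mapping.keys m \<subseteq> {..<N}"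
  shows "sym_iota d N p m = Poly_Mapping.lookup p m"
proof -
  obtain F where "F \<in> Sym_le d" "restrict_vars N F = p"
    using restrict_vars_surj[OF assms(1)] .
  hence im: "p \<in> restrict_vars N ` Sym_le d" by blast
  have "sym_iota d N p \<in> Sym_le d" "restrict_vars N (sym_iota d N p) = p"
    unfolding sym_iota_def using inv_into_into[OF im] f_inv_into_f[OF im] by auto
  thus ?thesis using lookup_restrict_vars[of "sym_iota d N p" d N m] assms(2) by simp
qed

lemma eventually_keys_subset: "\<forall>\<^sub>F N in sequentially. Poly_Mapping.keys (m :: monomial) \<subseteq> {..<N}"
proof -
  obtain n where "\<forall>i\<in>Poly_Mapping.keys m. i < n"
    using finite_nat_set_iff_bounded[of "Poly_Mapping.keys m"] by auto
  thus ?thesis by (intro eventually_sequentiallyI[of n]) force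
qed

lemma SymN_le_mono: "p \<in> SymN_le d N \<Longrightarrow> d \<le> e \<Longrightarrow> p \<in> SymN_le e N"
  by (auto simp: SymN_le_def)

lemma sym_iota_tendsto_iff:
  assumes "\<And>N. N \<ge> N0 \<Longrightarrow> F N \<in> SymN_le D N" "D \<le> d"
  shows "(\<lambda>N. sym_iota d N (F N) m) \<longlonglongrightarrow> x \<longleftrightarrow> (\<lambda>N. Poly_Mapping.lookup (F N) m) \<longlonglongrightarrow> x"
proof (rule tendsto_cong)
  show "\<forall>\<^sub>F N in sequentially. sym_iota d N (F N) m = Poly_Mapping.lookup (F N) m"
    using eventually_keys_subset[of m] eventually_ge_at_top[of N0]
    by eventually_elim (metis assms SymN_le_mono sym_iota_eq)
qed

text \<open>The limit inherits membership in \<open>Sym_le\<close>: a coefficient above the degree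
  bound is 0 along the sequence, and a monomial and its rearrangement both involve only the first
  \<open>N\<close> variables once \<open>N\<close> is large, so their coefficients agree before the
  limit.\<close>

lemma sym_convergesI:
  assumes "\<And>N. N \<ge> N0 \<Longrightarrow> F N \<in> SymN_le D N"
    and lim: "\<And>m. (\<lambda>N. Poly_Mapping.lookup (F N) m) \<longlonglongrightarrow> G m"
  shows "sym_converges N0 F G"
proof -
  have deg: "mdeg m \<le> D" if "G m \<noteq> 0" for m
  proof (rule ccontr)
    assume "\<not> mdeg m \<le> D"
    hence "\<forall>\<^sub>F N in sequentially. Poly_Mapping.lookup (F N) m = 0"
      using assms(1) by (intro eventually_sequentiallyI[of N0]) (force simp: SymN_le_def in_keys_iff)
    hence "(\<lambda>N. Poly_Mapping.lookup (F N) m) \<longlonglongrightarrow> 0" by (rule tendsto_eventually)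
    thus False using lim[of m] that LIMSEQ_unique by blast
  qed
  have sym: "G (Poly_Mapping.map_key \<pi> m) = G m" if "bij \<pi>" for \<pi> m
  proof (rule LIMSEQ_unique[OF lim])
    have "\<forall>\<^sub>F N in sequentially. Poly_Mapping.lookup (F N) m = Poly_Mapping.lookup (F N) (Poly_Mapping.map_key \<pi> m)"
      using eventually_keys_subset[of m] eventually_keys_subset[of "Poly_Mapping.map_key \<pi> m"]
        eventually_ge_at_top[of N0]
    proof eventually_elim
      case (elim N)
      thus ?case using assms(1)[of N] that SymN_lookup_map_key[of "F N" N \<pi> m]
        by (simp add: SymN_le_def)
    qed
    from tendsto_cong[OF this] lim[of m]
    show "(\<lambda>N. Poly_Mapping.lookup (F N) (Poly_Mapping.map_key \<pi> m)) \<longlonglongrightarrow> G m" by blast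
  qed
  have "G \<in> Sym_le d" if "d \<ge> D" for d
    using deg sym that by (fastforce simp: Sym_le_def intro: order_trans)
  thus ?thesis
    unfolding sym_converges_def using assms sym_iota_tendsto_iff[of N0 F D]
    by (intro conjI exI[of _ D] allI impI eventually_sequentiallyI[of D]) auto
qed

lemma sym_convergesD:
  assumes "sym_converges N0 F G"
  shows "(\<lambda>N. Poly_Mapping.lookup (F N) m) \<longlonglongrightarrow> G m"
proof -
  from assms obtain D where D: "\<And>N. N \<ge> N0 \<Longrightarrow> F N \<in> SymN_le D N"
    by (auto simp: sym_converges_def)
  from assms have "\<forall>\<^sub>F d in sequentially. (\<lambda>N. sym_iota d N (F N) m) \<longlonglongrightarrow> G m"
    by (auto simp: sym_converges_def elim: eventually_mono)
  hence "\<forall>\<^sub>F d in sequentially. (\<lambda>N. sym_iota d N (F N) m) \<longlonglongrightarrow> G m \<and> d \<ge> D"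
    using eventually_ge_at_top by (rule eventually_conj)
  then obtain d where "d \<ge> D" "(\<lambda>N. sym_iota d N (F N) m) \<longlonglongrightarrow> G m"
    by (auto simp: eventually_sequentially)
  thus ?thesis using sym_iota_tendsto_iff[of N0 F D d m] D by blast
qed

lemma sym_converges_unique:
  "sym_converges N0 F G \<Longrightarrow> sym_converges N0 F G' \<Longrightarrow> G = G'"
  by (rule ext) (rule LIMSEQ_unique[OF sym_convergesD sym_convergesD])

subsection \<open>Expansion by the Cauchy--Binet formula\<close>

text \<open>The \<open>N\<close>-element subsets of \<open>{..<L}\<close>, listed downwards because
  the exponents \<open>mu t + N - 1 - t\<close> of a partition decrease. Extensionality makes
  equality on \<open>{..<N}\<close> equality of functions.\<close>

definition descending_maps :: "nat \<Rightarrow> nat \<Rightarrow> (nat \<Rightarrow> nat) set" where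
  "descending_maps N L = {m \<in> {..<N} \<rightarrow>\<^sub>E {..<L}. \<forall>i j. i < j \<longrightarrow> j < N \<longrightarrow> m j < m i}"

lemma descending_maps_eqI:
  assumes m: "m \<in> descending_maps N L" and m': "m' \<in> descending_maps N L"
    and im: "m ` {..<N} = m' ` {..<N}"
  shows "m = m'"
proof -
  have "sorted_wrt (<) (rev (map m [0..<N]))" if "m \<in> descending_maps N L" for m
    using that unfolding sorted_wrt_rev by (auto simp: descending_maps_def sorted_wrt_iff_nth_less)
  moreover have "set (rev (map m [0..<N])) = m ` {..<N}" for m :: "nat \<Rightarrow> nat"
    by (auto simp: atLeast0LessThan)
  ultimately have "rev (map m [0..<N]) = rev (map m' [0..<N])"
    using strict_sorted_equal[of "rev (map m' [0..<N])" "rev (map m [0..<N])"] assms by simp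
  hence "\<forall>i<N. m i = m' i" by (simp add: map_eq_conv)
  moreover have "m \<in> {..<N} \<rightarrow>\<^sub>E {..<L}" "m' \<in> {..<N} \<rightarrow>\<^sub>E {..<L}"
    using m m' by (simp_all add: descending_maps_def)
  ultimately show ?thesis by (intro PiE_ext) auto
qed

lemma descending_maps_enum:
  assumes "S \<subseteq> {..<L}" "card S = N"
  obtains m where "m \<in> descending_maps N L" "m ` {..<N} = S"
proof -
  have fin: "finite S" using assms(1) finite_subset by blast
  define xs where "xs = rev (sorted_list_of_set S)"
  define m where "m = (\<lambda>i\<in>{..<N}. xs ! i)"
  have len: "length xs = N" using assms(2) fin by (simp add: xs_def)
  have set: "set xs = S" using fin by (simp add: xs_def)
  have "sorted_wrt (>) xs"
    unfolding xs_def sorted_wrt_rev by (rule strict_sorted_list_of_set)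
  hence "m j < m i" if "i < j" "j < N" for i j
    using that len by (auto simp: m_def sorted_wrt_iff_nth_less)
  moreover have im: "m ` {..<N} = S"
    using set len by (auto simp: m_def set_conv_nth image_def)
  ultimately have "m \<in> descending_maps N L"
    using assms(1) by (auto simp: descending_maps_def m_def)
  thus ?thesis using im that by blast
qed

lemma descending_maps_inj:
  assumes "m \<in> descending_maps N L" shows "inj_on m {..<N}"
proof (rule linorder_inj_onI')
  fix i j assume "i \<in> {..<N}" "j \<in> {..<N}" "i < j"
  hence "m j < m i" using assms by (simp add: descending_maps_def)
  thus "m i \<noteq> m j" by simp
qed

text \<open>An injective selection of indices is its image, sorted downwards, together with an
  ordering of that image.\<close>

lemma bij_betw_descending_maps:
  "bij_betw (\<lambda>(m, p). \<lambda>i\<in>{..<N}. m (p i)) (descending_maps N L \<times> {p. p permutes {..<N}})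
     {f \<in> {..<N} \<rightarrow>\<^sub>E {..<L}. inj_on f {..<N}}"
proof (rule bij_betwI')
  fix x y
  assume xy: "x \<in> descending_maps N L \<times> {p. p permutes {..<N}}"
    "y \<in> descending_maps N L \<times> {p. p permutes {..<N}}"
  obtain m p m' p' where eq: "x = (m, p)" "y = (m', p')" by fastforce
  have m: "m \<in> descending_maps N L" "m' \<in> descending_maps N L"
    and p: "p permutes {..<N}" "p' permutes {..<N}"
    using xy eq by auto
  show "((case x of (m, p) \<Rightarrow> \<lambda>i\<in>{..<N}. m (p i)) = (case y of (m, p) \<Rightarrow> \<lambda>i\<in>{..<N}. m (p i))) = (x = y)"
  proof
    assume "(case x of (m, p) \<Rightarrow> \<lambda>i\<in>{..<N}. m (p i)) = (case y of (m, p) \<Rightarrow> \<lambda>i\<in>{..<N}. m (p i))"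
    hence "(\<lambda>i\<in>{..<N}. m (p i)) = (\<lambda>i\<in>{..<N}. m' (p' i))" by (simp add: eq)
    hence e: "m (p i) = m' (p' i)" if "i < N" for i
      using that by (metis lessThan_iff restrict_apply')
    have "m ` {..<N} = (\<lambda>i. m (p i)) ` {..<N}"
      using permutes_image[OF p(1)] by (metis image_image)
    also have "\<dots> = (\<lambda>i. m' (p' i)) ` {..<N}"
      using e by (intro image_cong) auto
    also have "\<dots> = m' ` {..<N}"
      using permutes_image[OF p(2)] by (metis image_image)
    finally have mm: "m = m'" by (rule descending_maps_eqI[OF m])
    have "p i = p' i" for i
    proof (cases "i < N")
      case True
      thus ?thesis
        using e[OF True] p inj_onD[OF descending_maps_inj[OF m(1)], of "p i" "p' i"]
        by (simp add: mm permutes_lessThan_less)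
    next
      case False
      thus ?thesis using p by (simp add: permutes_not_in)
    qed
    thus "x = y" by (auto simp: eq mm)
  qed simp
next
  fix x assume "x \<in> descending_maps N L \<times> {p. p permutes {..<N}}"
  then obtain m p where x: "x = (m, p)" and m: "m \<in> descending_maps N L" and p: "p permutes {..<N}"
    by auto
  have "inj_on (m \<circ> p) {..<N}"
    using p descending_maps_inj[OF m]
    by (intro comp_inj_on) (auto simp: permutes_image permutes_inj_on)
  moreover have "m i < L" if "i < N" for i
    using m that by (auto simp: descending_maps_def)
  ultimately show "(case x of (m, p) \<Rightarrow> \<lambda>i\<in>{..<N}. m (p i)) \<in> {f \<in> {..<N} \<rightarrow>\<^sub>E {..<L}. inj_on f {..<N}}"
    using p by (auto simp: x inj_on_def permutes_lessThan_less)
next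
  fix f assume f: "f \<in> {f \<in> {..<N} \<rightarrow>\<^sub>E {..<L}. inj_on f {..<N}}"
  have "f ` {..<N} \<subseteq> {..<L}" "card (f ` {..<N}) = N"
    using f by (auto simp: card_image)
  then obtain m where m: "m \<in> descending_maps N L" "m ` {..<N} = f ` {..<N}"
    using descending_maps_enum by blast
  define p where "p i = (if i < N then inv_into {..<N} m (f i) else i)" for i
  have mp: "m (p i) = f i" if "i < N" for i
    using that m(2) by (auto simp: p_def intro!: f_inv_into_f)
  have "p i < N" if "i < N" for i
    using that m(2) inv_into_into[of "f i" m "{..<N}"] by (auto simp: p_def)
  moreover have "inj_on p {..<N}"
    using f mp by (intro inj_onI) (metis (mono_tags, lifting) inj_onD lessThan_iff mem_Collect_eq)
  moreover from calculation have "p ` {..<N} = {..<N}"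
    by (intro endo_inj_surj) auto
  ultimately have "p permutes {..<N}"
    by (intro bij_imp_permutes bij_betw_imageI) (auto simp: p_def)
  moreover have "f = (\<lambda>i\<in>{..<N}. m (p i))"
    using f mp by (intro PiE_ext[of f "{..<N}" "\<lambda>_. {..<L}"]) auto
  ultimately show "\<exists>x\<in>descending_maps N L \<times> {p. p permutes {..<N}}. f = (case x of (m, p) \<Rightarrow> \<lambda>i\<in>{..<N}. m (p i))"
    using m by (intro bexI[of _ "(m, p)"]) auto
qed

lemma detn_eq_rows:
  assumes "i < n" "k < n" "i \<noteq> k" "\<And>j. j < n \<Longrightarrow> a i j = a k j"
  shows "detn n a = 0"
  using assms by (intro det_identical_rows[of _ n i k]) (auto intro!: eq_vecI)

text \<open>Multilinearity gives a sum over all selections \<open>f\<close> of summation indices.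
  Selections with a repetition produce equal rows and vanish; the injective ones are grouped by
  image, and the signed sum over the orderings rebuilds the determinant of \<open>a\<close>.\<close>

lemma detn_cauchy_binet:
  fixes a g :: "nat \<Rightarrow> nat \<Rightarrow> 'a::comm_ring_1"
  shows "detn N (\<lambda>i j. \<Sum>k<L. a i k * g k j) =
    (\<Sum>m\<in>descending_maps N L. detn N (\<lambda>i t. a i (m t)) * detn N (\<lambda>t j. g (m t) j))"
proof -
  define h where "h f = (\<Prod>i<N. a i (f i)) * detn N (\<lambda>i j. g (f i) j)" for f
  let ?F = "{..<N} \<rightarrow>\<^sub>E {..<L}"
  let ?P = "{p. p permutes {..<N}}"
  have "detn N (\<lambda>i j. \<Sum>k<L. a i k * g k j) =
      (\<Sum>p\<in>?P. of_int (sign p) * (\<Sum>f\<in>?F. \<Prod>i<N. a i (f i) * g (f i) (p i)))"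
    unfolding detn_def by (simp add: prod_sum_PiE)
  also have "\<dots> = (\<Sum>f\<in>?F. h f)"
    unfolding h_def detn_def sum_distrib_left
    by (subst sum.swap) (simp add: prod.distrib mult_ac)
  also have "\<dots> = (\<Sum>f | f \<in> ?F \<and> inj_on f {..<N}. h f)"
  proof (rule sum.mono_neutral_right)
    show "\<forall>f \<in> ?F - {f \<in> ?F. inj_on f {..<N}}. h f = 0"
    proof
      fix f assume "f \<in> ?F - {f \<in> ?F. inj_on f {..<N}}"
      then obtain i k where "i < N" "k < N" "i \<noteq> k" "f i = f k" by (auto simp: inj_on_def)
      thus "h f = 0" unfolding h_def by (subst detn_eq_rows[of i N k]) auto
    qed
  qed (auto intro!: finite_PiE)
  also have "\<dots> = (\<Sum>(m, p)\<in>descending_maps N L \<times> ?P. h (\<lambda>i\<in>{..<N}. m (p i)))"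
    by (subst sum.reindex_bij_betw[OF bij_betw_descending_maps, symmetric]) (simp add: case_prod_unfold)
  also have "\<dots> = (\<Sum>m\<in>descending_maps N L. \<Sum>p\<in>?P. h (\<lambda>i\<in>{..<N}. m (p i)))"
    by (rule sum.cartesian_product[symmetric])
  also have "\<dots> = (\<Sum>m\<in>descending_maps N L. detn N (\<lambda>i t. a i (m t)) * detn N (\<lambda>t j. g (m t) j))"
  proof (rule sum.cong[OF refl])
    fix m
    have "h (\<lambda>i\<in>{..<N}. m (p i)) =
        of_int (sign p) * (\<Prod>i<N. a i (m (p i))) * detn N (\<lambda>t j. g (m t) j)" if "p permutes {..<N}" for p
    proof -
      have "detn N (\<lambda>i j. g ((\<lambda>i\<in>{..<N}. m (p i)) i) j) = detn N (\<lambda>i j. g (m (p i)) j)"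
        by (rule detn_cong) simp
      also have "\<dots> = of_int (sign p) * detn N (\<lambda>t j. g (m t) j)"
        by (rule detn_permute_rows[OF that])
      finally show ?thesis by (simp add: h_def mult_ac)
    qed
    thus "(\<Sum>p\<in>?P. h (\<lambda>i\<in>{..<N}. m (p i))) = detn N (\<lambda>i t. a i (m t)) * detn N (\<lambda>t j. g (m t) j)"
      by (simp add: detn_def[of N "\<lambda>i t. a i (m t)"] sum_distrib_right)
  qed
  finally show ?thesis .
qed

text \<open>The zero block has \<open>n - j\<close> rows and \<open>j + 1\<close> columns, together
  more than \<open>n\<close>. A permutation avoiding it would inject \<open>n - j\<close> rows into
  \<open>n - j - 1\<close> columns, so every term of the Leibniz sum contains a zero.\<close>

lemma detn_zero_block:
  assumes "j < n" "\<And>i k. j \<le> i \<Longrightarrow> i < n \<Longrightarrow> k \<le> j \<Longrightarrow> a i k = 0"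
  shows "detn n a = 0"
  unfolding detn_def
proof (rule sum.neutral, safe)
  fix p assume p: "p permutes {..<n}"
  have "\<exists>i. j \<le> i \<and> i < n \<and> p i \<le> j"
  proof (rule ccontr)
    assume "\<not> ?thesis"
    hence "p ` {j..<n} \<subseteq> {j<..<n}" using p by (auto simp: permutes_lessThan_less not_le)
    hence "card {j..<n} \<le> card {j<..<n}"
      using p by (intro card_inj_on_le[of p]) (auto simp: permutes_inj_on)
    thus False using assms(1) by simp
  qed
  then obtain i where "j \<le> i" "i < n" "p i \<le> j" by blast
  hence "(\<Prod>i<n. a i (p i)) = 0" using assms(2)[of i "p i"] by (intro prod_zero) auto
  thus "of_int (sign p) * (\<Prod>i<n. a i (p i)) = 0" by simp
qed

section \<open>Partitions and strictly decreasing exponent sequences\<close>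

lemma partition_support:
  assumes "is_partition lam"
  shows "{i. lam i \<noteq> 0} = {..<part_length lam}"
proof -
  have fin: "finite {i. lam i \<noteq> 0}" and anti: "antimono lam"
    using assms by (auto simp: is_partition_def)
  have down: "lam i \<noteq> 0" if "i \<le> j" "lam j \<noteq> 0" for i j
    using antimonoD[OF anti that(1)] that(2) by simp
  obtain n where n: "lam n = 0" using ex_new_if_finite[OF infinite_UNIV_nat fin] by auto
  define l where "l = (LEAST n. lam n = 0)"
  have "lam l = 0" unfolding l_def using n by (rule LeastI)
  hence "lam i \<noteq> 0 \<longleftrightarrow> i < l" for i
    using down[of l i] not_less_Least[of i "\<lambda>n. lam n = 0", folded l_def] by (cases "l \<le> i") auto
  hence "{i. lam i \<noteq> 0} = {..<l}" by auto
  thus ?thesis by (simp add: part_length_def)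
qed

lemma partition_eq_0: "is_partition lam \<Longrightarrow> part_length lam \<le> i \<Longrightarrow> lam i = 0"
  using partition_support[of lam] by (metis (mono_tags) lessThan_iff mem_Collect_eq not_less)

lemma partition_mono: "is_partition lam \<Longrightarrow> i \<le> j \<Longrightarrow> lam j \<le> lam i"
  by (simp add: is_partition_def antimonoD)

lemma part_size_eq:
  assumes "is_partition lam" "part_length lam \<le> N"
  shows "part_size lam = (\<Sum>i<N. lam i)"
  unfolding part_size_def partition_support[OF assms(1)] using assms
  by (intro sum.mono_neutral_left) (auto intro: partition_eq_0)

lemma part_length_mono:
  assumes "is_partition mu" "is_partition lam" "part_subset mu lam"
  shows "part_length mu \<le> part_length lam"
proof -
  have "{i. mu i \<noteq> 0} \<subseteq> {i. lam i \<noteq> 0}"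
    using assms(3) unfolding part_subset_def by (metis (mono_tags, lifting) Collect_mono le_zero_eq)
  thus ?thesis using partition_support assms by simp
qed

lemma bij_betw_subpartitions:
  assumes "is_partition lam" "part_length lam \<le> N"
  shows "bij_betw (\<lambda>mu. \<lambda>t\<in>{..<N}. mu t + N - 1 - t) {mu. is_partition mu \<and> part_subset mu lam}
     {m \<in> descending_maps N (lam 0 + N). \<forall>t<N. m t \<le> lam t + N - 1 - t}"
proof (rule bij_betwI')
  fix mu nu
  assume mu: "mu \<in> {mu. is_partition mu \<and> part_subset mu lam}" and nu: "nu \<in> {mu. is_partition mu \<and> part_subset mu lam}"
  show "((\<lambda>t\<in>{..<N}. mu t + N - 1 - t) = (\<lambda>t\<in>{..<N}. nu t + N - 1 - t)) = (mu = nu)"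
  proof
    assume eq: "(\<lambda>t\<in>{..<N}. mu t + N - 1 - t) = (\<lambda>t\<in>{..<N}. nu t + N - 1 - t)"
    show "mu = nu"
    proof
      fix t
      show "mu t = nu t"
      proof (cases "t < N")
        case True
        thus ?thesis using fun_cong[OF eq, of t] by simp
      next
        case False
        hence "mu t \<le> lam t" "nu t \<le> lam t" "lam t = 0"
          using mu nu assms by (auto simp: part_subset_def intro: partition_eq_0)
        thus ?thesis by simp
      qed
    qed
  qed simp
next
  fix mu
  assume mu: "mu \<in> {mu. is_partition mu \<and> part_subset mu lam}"
  have le: "mu t \<le> lam t" "lam t \<le> lam 0" for t
    using mu assms(1) by (auto simp: part_subset_def intro: partition_mono)
  have mono: "mu j \<le> mu i" if "i < j" for i j
    using mu that by (auto intro: partition_mono)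
  have "mu t + N - 1 - t \<le> lam t + N - 1 - t" for t
    using le(1)[of t] by simp
  moreover have "mu t + N - 1 - t < lam 0 + N" if "t < N" for t
    using le[of t] that by linarith
  moreover have "mu j + N - 1 - j < mu i + N - 1 - i" if "i < j" "j < N" for i j
    using mono[OF that(1)] that by linarith
  ultimately show "(\<lambda>t\<in>{..<N}. mu t + N - 1 - t) \<in>
      {m \<in> descending_maps N (lam 0 + N). \<forall>t<N. m t \<le> lam t + N - 1 - t}"
    by (simp add: descending_maps_def)
next
  fix m
  assume m: "m \<in> {m \<in> descending_maps N (lam 0 + N). \<forall>t<N. m t \<le> lam t + N - 1 - t}"
  hence desc: "m j < m i" if "i < j" "j < N" for i j
    using that by (auto simp: descending_maps_def)
  \<comment> \<open>Strict descent through naturals forces this lower bound, counted from the last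
    index; it keeps the subtraction in the definition of \<open>mu\<close> from being
    truncated.\<close>
  have ge: "s \<le> m (N - 1 - s)" if "s < N" for s
    using that
  proof (induction s)
    case (Suc s)
    hence "m (N - 1 - s) < m (N - 1 - Suc s)" by (intro desc) auto
    thus ?case using Suc by simp
  qed simp
  have ge': "N - 1 - t \<le> m t" if "t < N" for t
    using ge[of "N - 1 - t"] that by simp
  define mu where "mu t = (if t < N then m t - (N - 1 - t) else 0)" for t
  have "mu (Suc t) \<le> mu t" for t
    using desc[of t "Suc t"] ge'[of t] ge'[of "Suc t"] by (auto simp: mu_def)
  hence "antimono mu" by (simp add: antimono_iff_le_Suc)
  moreover have "{t. mu t \<noteq> 0} \<subseteq> {..<N}" by (auto simp: mu_def)
  hence "finite {t. mu t \<noteq> 0}" using finite_subset by blast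
  moreover have "mu t \<le> lam t" for t
    using m ge'[of t] by (auto simp: mu_def)
  ultimately have "is_partition mu \<and> part_subset mu lam"
    by (simp add: is_partition_def part_subset_def)
  moreover have "m = (\<lambda>t\<in>{..<N}. mu t + N - 1 - t)"
  proof -
    have "mu t + N - 1 - t = m t" if "t < N" for t
      using ge'[OF that] that by (simp add: mu_def)
    hence "(\<lambda>t\<in>{..<N}. mu t + N - 1 - t) = restrict m {..<N}"
      by (intro restrict_ext) simp
    also have "\<dots> = m" using m by (intro PiE_restrict[of m _ "\<lambda>_. {..<lam 0 + N}"]) (simp add: descending_maps_def)
    finally show ?thesis by simp
  qed
  ultimately show "\<exists>mu\<in>{mu. is_partition mu \<and> part_subset mu lam}. m = (\<lambda>t\<in>{..<N}. mu t + N - 1 - t)"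
    by blast
qed

lemma finite_descending_maps: "finite (descending_maps N L)"
  unfolding descending_maps_def by (intro finite_Collect_conjI disjI1) (auto simp: finite_PiE)

lemma subst_var_sum_smult:
  "subst_var (\<Sum>k\<in>K. smult (a k) (g k)) j = (\<Sum>k\<in>K. Const (a k) * subst_var (g k) j)"
proof (induction K rule: infinite_finite_induct)
  case (insert k K)
  define n where "n = max (Polynomial.degree (smult (a k) (g k)))
    (max (Polynomial.degree (\<Sum>k\<in>K. smult (a k) (g k))) (Polynomial.degree (g k)))"
  have n: "Polynomial.degree (smult (a k) (g k)) \<le> n" "Polynomial.degree (\<Sum>k\<in>K. smult (a k) (g k)) \<le> n"
    "Polynomial.degree (g k) \<le> n" unfolding n_def by auto
  hence n': "Polynomial.degree (smult (a k) (g k) + (\<Sum>k\<in>K. smult (a k) (g k))) \<le> n"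
    by (intro degree_add_le)
  have "subst_var (smult (a k) (g k) + (\<Sum>k\<in>K. smult (a k) (g k))) j =
      Const (a k) * subst_var (g k) j + subst_var (\<Sum>k\<in>K. smult (a k) (g k)) j"
    using n n' by (simp add: subst_var_def poly_map_Const[of _ n] Const_add Const_mult
        distrib_right sum.distrib sum_distrib_left mult.assoc)
  thus ?case using insert by simp
qed (simp_all add: subst_var_def)

text \<open>If an index set violates \<open>m t \<le> l t\<close> at some \<open>t\<close>,
  monotonicity gives \<open>l i < m k\<close> for all \<open>i \<ge> t\<close> and
  \<open>k \<le> t\<close>, a zero block that kills the minor. Hence only partitions inside
  \<open>lam\<close> occur. Beyond the length of \<open>lam\<close> both partitions are zero, so the
  diagonal entries are \<open>A n n = 1\<close> and those to their left are zero.\<close>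

theorem det_quotient_expand:
  assumes lam: "is_partition lam" "part_length lam \<le> N"
    and f: "\<And>n. f n = (\<Sum>k\<le>n. smult (A n k) (g k))"
    and A: "\<And>n. A n n = 1" "\<And>n k. n < k \<Longrightarrow> A n k = 0"
  shows "det_quotient N f lam =
    (\<Sum>mu | is_partition mu \<and> part_subset mu lam.
       Const (detn (part_length lam) (\<lambda>i j. A (lam i + N - 1 - i) (mu j + N - 1 - j))) *
       det_quotient N g mu)"
proof -
  define L where "L = lam 0 + N"
  define l where "l i = lam i + N - 1 - i" for i
  have l: "l i < L" if "i < N" for i
    using that partition_mono[OF lam(1), of 0 i] by (auto simp: l_def L_def)
  have l_mono: "l j \<le> l i" if "i \<le> j" "j < N" for i j
    using that partition_mono[OF lam(1), of i j] by (auto simp: l_def)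
  \<comment> \<open>Padding with zeros brings all rows to one summation range;
    \<open>L = lam 0 + N\<close> exceeds every degree in the alternant.\<close>
  have "f n = (\<Sum>k<L. smult (A n k) (g k))" if "n < L" for n
    unfolding f by (rule sum.mono_neutral_left) (use that A in auto)
  hence "alternant N f lam = detn N (\<lambda>i j. \<Sum>k<L. Const (A (l i) k) * subst_var (g k) j)"
    unfolding alternant_def l_def[symmetric] by (intro detn_cong) (simp add: l subst_var_sum_smult)
  also have "\<dots> = (\<Sum>m\<in>descending_maps N L. detn N (\<lambda>i t. Const (A (l i) (m t))) *
      detn N (\<lambda>t j. subst_var (g (m t)) j))"
    by (rule detn_cauchy_binet)
  also have "\<dots> = (\<Sum>m | m \<in> descending_maps N L \<and> (\<forall>t<N. m t \<le> l t). detn N (\<lambda>i t. Const (A (l i) (m t))) *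
      detn N (\<lambda>t j. subst_var (g (m t)) j))"
  proof (rule sum.mono_neutral_right)
    show "\<forall>m\<in>descending_maps N L - {m \<in> descending_maps N L. \<forall>t<N. m t \<le> l t}.
        detn N (\<lambda>i t. Const (A (l i) (m t))) * detn N (\<lambda>t j. subst_var (g (m t)) j) = 0"
    proof
      fix m assume "m \<in> descending_maps N L - {m \<in> descending_maps N L. \<forall>t<N. m t \<le> l t}"
      then obtain t where t: "t < N" "l t < m t" and m: "m \<in> descending_maps N L"
        by (auto simp: not_le)
      have "detn N (\<lambda>i t. Const (A (l i) (m t))) = 0"
      proof (rule detn_zero_block[OF t(1)])
        fix i k assume ik: "t \<le> i" "i < N" "k \<le> t"
        have "m t \<le> m k" using m ik t(1) by (cases "k = t") (auto simp: descending_maps_def intro: less_imp_le)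
        hence "l i < m k" using l_mono[of t i] ik t(2) by simp
        thus "Const (A (l i) (m k)) = 0" by (simp add: A(2))
      qed
      thus "detn N (\<lambda>i t. Const (A (l i) (m t))) * detn N (\<lambda>t j. subst_var (g (m t)) j) = 0" by simp
    qed
  qed (auto simp: finite_descending_maps)
  also have "\<dots> = (\<Sum>mu | is_partition mu \<and> part_subset mu lam.
      detn N (\<lambda>i t. Const (A (l i) (mu t + N - 1 - t))) * alternant N g mu)"
    unfolding L_def l_def alternant_def
    by (subst sum.reindex_bij_betw[OF bij_betw_subpartitions[OF lam], symmetric])
       (intro sum.cong refl arg_cong2[of _ _ _ _ "(*)"] detn_cong, simp_all)
  also have "\<dots> = (\<Sum>mu | is_partition mu \<and> part_subset mu lam.
      Const (detn (part_length lam) (\<lambda>i j. A (l i) (mu j + N - 1 - j))) * alternant N g mu)"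
  proof (intro sum.cong refl)
    fix mu assume mu: "mu \<in> {mu. is_partition mu \<and> part_subset mu lam}"
    have zero: "lam i = 0" "mu i = 0" if "part_length lam \<le> i" for i
      using that lam mu part_length_mono[of mu lam] by (auto intro: partition_eq_0)
    have "detn N (\<lambda>i t. Const (A (l i) (mu t + N - 1 - t))) = Const (detn N (\<lambda>i t. A (l i) (mu t + N - 1 - t)))"
      by (simp add: detn_hom[OF Const_hom.comm_ring_hom_axioms])
    also have "detn N (\<lambda>i t. A (l i) (mu t + N - 1 - t)) = detn (part_length lam) (\<lambda>i t. A (l i) (mu t + N - 1 - t))"
      using lam(2) zero by (intro detn_reduce A) (auto simp: l_def A(1))
    finally show "detn N (\<lambda>i t. Const (A (l i) (mu t + N - 1 - t))) * alternant N g mu =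
      Const (detn (part_length lam) (\<lambda>i j. A (l i) (mu j + N - 1 - j))) * alternant N g mu" by simp
  qed
  finally show ?thesis
    unfolding l_def by (intro det_quotient_unique)
      (simp add: sum_distrib_right mult.assoc det_quotient_vandermonde)
qed

subsection \<open>Convergence of the interpolation functions\<close>

lemma lookup_det_quotient_expand:
  assumes "is_partition lam" "part_length lam \<le> N"
    and "\<And>n. f n = (\<Sum>k\<le>n. smult (A n k) (g k))"
    and "\<And>n. A n n = 1" "\<And>n k. n < k \<Longrightarrow> A n k = 0"
  shows "Poly_Mapping.lookup (det_quotient N f lam) m =
    (\<Sum>mu | is_partition mu \<and> part_subset mu lam.
       detn (part_length lam) (\<lambda>i j. A (lam i + N - 1 - i) (mu j + N - 1 - j)) *
       Poly_Mapping.lookup (det_quotient N g mu) m)"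
  by (subst det_quotient_expand[OF assms]) (simp_all add: lookup_sum Const_mult_lookup)

lemma lookup_det_quotient_schur:
  assumes "is_partition lam" "part_length lam \<le> N"
    and "\<And>n. Polynomial.degree (f n) = n" "\<And>n. lead_coeff (f n) = 1"
  shows "Poly_Mapping.lookup (det_quotient N f lam) m =
    (\<Sum>mu | is_partition mu \<and> part_subset mu lam.
       detn (part_length lam) (\<lambda>i j. poly.coeff (f (lam i + N - 1 - i)) (mu j + N - 1 - j)) *
       Poly_Mapping.lookup (schur N mu) m)"
proof (rule lookup_det_quotient_expand[OF assms(1,2)])
  show "f n = (\<Sum>k\<le>n. smult (poly.coeff (f n) k) (monom 1 k))" for n
    using poly_as_sum_of_monoms[of "f n"] by (simp add: assms(3) smult_monom)
  show "poly.coeff (f n) n = 1" for n using assms(3,4)[of n] by simp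
  show "poly.coeff (f n) k = 0" if "n < k" for n k using that assms(3) by (simp add: coeff_eq_0)
qed

text \<open>The Schur polynomials in the expansion are homogeneous, of degrees at most the size of
  \<open>lam\<close>. This bound is uniform in \<open>N\<close>, as convergence requires.\<close>

lemma det_quotient_SymN_le:
  assumes "is_partition lam" "part_length lam \<le> N"
    and "\<And>n. Polynomial.degree (f n) = n" "\<And>n. lead_coeff (f n) = 1"
  shows "det_quotient N f lam \<in> SymN_le (part_size lam) N"
proof -
  have "mdeg m \<le> part_size lam" if "Poly_Mapping.lookup (det_quotient N f lam) m \<noteq> 0" for m
  proof -
    from that have "\<exists>mu\<in>{mu. is_partition mu \<and> part_subset mu lam}. Poly_Mapping.lookup (schur N mu) m \<noteq> 0"
      unfolding lookup_det_quotient_schur[OF assms] by (metis (mono_tags, lifting) mult_zero_right sum.neutral)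
    then obtain mu where mu: "part_subset mu lam" "Poly_Mapping.lookup (schur N mu) m \<noteq> 0" by blast
    hence "mdeg m = (\<Sum>i<N. mu i)" using schur_homogeneous by blast
    also have "\<dots> \<le> (\<Sum>i<N. lam i)" using mu(1) by (intro sum_mono) (simp add: part_subset_def)
    finally show ?thesis using part_size_eq[OF assms(1,2)] by simp
  qed
  thus ?thesis using det_quotient_SymN[of N f lam] by (auto simp: SymN_le_def in_keys_iff)
qed

lemma lookup_schur_convergent:
  assumes "is_partition mu"
  shows "convergent (\<lambda>N. Poly_Mapping.lookup (schur N mu) m)"
proof -
  obtain n where n: "Poly_Mapping.keys m \<subseteq> {..<n}" "part_length mu \<le> n"
    using eventually_conj[OF eventually_keys_subset[of m] eventually_ge_at_top[of "part_length mu"]]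
    by (auto simp: eventually_sequentially)
  have "\<forall>\<^sub>F N in sequentially. Poly_Mapping.lookup (schur N mu) m = Poly_Mapping.lookup (schur n mu) m"
  proof (rule eventually_sequentiallyI)
    fix N assume "n \<le> N"
    show "Poly_Mapping.lookup (schur N mu) m = Poly_Mapping.lookup (schur n mu) m"
      by (rule lookup_schur_stable) (use n \<open>n \<le> N\<close> partition_eq_0[OF assms] in auto)
  qed
  thus ?thesis by (intro convergentI tendsto_eventually)
qed

lemma tendsto_detn:
  fixes X :: "'b \<Rightarrow> nat \<Rightarrow> nat \<Rightarrow> complex"
  assumes "\<And>i j. i < n \<Longrightarrow> j < n \<Longrightarrow> ((\<lambda>N. X N i j) \<longlongrightarrow> Y i j) F"
  shows "((\<lambda>N. detn n (X N)) \<longlongrightarrow> detn n Y) F"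
  unfolding detn_def by (intro tendsto_intros assms) (auto simp: permutes_lessThan_less)

section \<open>Coefficients of shifted powers, counted from the top\<close>

lemma degree_shifted_power: "Polynomial.degree (shifted_power cs n) = n"
  unfolding shifted_power_def by (subst degree_prod_eq_sum_degree) auto

lemma lead_coeff_shifted_power: "lead_coeff (shifted_power cs n) = 1"
  unfolding shifted_power_def by (subst lead_coeff_prod) simp

text \<open>Degree and index both grow with \<open>N\<close> while their difference stays fixed.
  Reflection turns this into a coefficient of fixed index in the product of the factors
  \<open>1 - cs i z\<close>.\<close>

lemma coeff_shifted_power:
  "poly.coeff (shifted_power cs n) k =
    (if k \<le> n then poly.coeff (\<Prod>i<n. [:1, - cs i:]) (n - k) else 0)"
proof -
  have "reflect_poly [:- c, 1:] = [:1, - c:]" for c :: complex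
    by (simp add: reflect_poly_def)
  hence "reflect_poly (shifted_power cs n) = (\<Prod>i<n. [:1, - cs i:])"
    by (simp add: shifted_power_def reflect_poly_prod)
  moreover have "poly.coeff (reflect_poly (shifted_power cs n)) (n - k) = poly.coeff (shifted_power cs n) k" if "k \<le> n"
    using that by (simp add: coeff_reflect_poly degree_shifted_power)
  ultimately show ?thesis by (simp add: coeff_eq_0 degree_shifted_power)
qed

text \<open>One more factor changes coefficient \<open>r + 1\<close> by \<open>- b q^t\<close> times
  coefficient \<open>r\<close>. The latter is bounded by induction, so the increments are dominated
  by a geometric series.\<close>

lemma convergent_coeff_product:
  fixes P :: "nat \<Rightarrow> complex poly"
  assumes "norm q < 1" "\<And>t. P (Suc t) = [:1, - (b * q ^ t):] * P t"
  shows "convergent (\<lambda>t. poly.coeff (P t) r)"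
proof (induction r)
  case 0
  have "poly.coeff (P (Suc t)) 0 = poly.coeff (P t) 0" for t
    by (simp add: assms(2) coeff_mult_0)
  hence "poly.coeff (P t) 0 = poly.coeff (P 0) 0" for t by (induction t) simp_all
  hence "(\<lambda>t. poly.coeff (P t) 0) = (\<lambda>_. poly.coeff (P 0) 0)" by blast
  thus ?case by (metis convergent_const)
next
  case (Suc r)
  then obtain C where C: "\<And>t. norm (poly.coeff (P t) r) \<le> C"
    using convergent_imp_Bseq BseqE by metis
  define X where "X t = poly.coeff (P t) (Suc r)" for t
  have diff: "X (Suc t) - X t = - (b * q ^ t * poly.coeff (P t) r)" for t
    by (simp add: X_def assms(2))
  have "summable (\<lambda>t. X (Suc t) - X t)"
  proof (rule summable_comparison_test')
    show "summable (\<lambda>t. (norm b * C) * norm q ^ t)"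
      using assms(1) by (intro summable_mult summable_geometric) simp
    show "norm (X (Suc t) - X t) \<le> (norm b * C) * norm q ^ t" if "t \<ge> 0" for t
      using mult_left_mono[OF C, of "norm b * norm q ^ t" t]
      by (simp add: diff norm_mult norm_power mult_ac)
  qed
  hence "convergent (\<lambda>n. \<Sum>t<n. X (Suc t) - X t)" by (simp add: summable_iff_convergent)
  hence "convergent (\<lambda>n. X n - X 0)" by (simp add: sum_lessThan_telescope)
  hence "convergent (\<lambda>n. (X n - X 0) + X 0)" by (intro convergent_add convergent_const)
  thus ?case by (simp add: X_def)
qed

text \<open>The factors carry the powers of \<open>q\<close> with exponents from
  \<open>i + 1 - a\<close> to \<open>N - 1\<close>. The lower end is fixed, so for
  \<open>N > i\<close> the passage to \<open>N + 1\<close> only adds the factor with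
  \<open>q^N\<close>.\<close>

lemma convergent_coeff_shifted_power:
  assumes "norm q < 1" "q \<noteq> 0"
  shows "convergent (\<lambda>N. poly.coeff (shifted_power (\<lambda>i. q powi (int N - 1 - int i)) (a + N - 1 - i)) (b + N - 1 - j))"
proof -
  define E where "E N = (\<Prod>s<a + N - 1 - i. [:1, - (q powi (int N - 1 - int s)):])" for N
  \<comment> \<open>Starting at \<open>N = i + 1\<close> makes the number of factors
    \<open>a + t\<close>, free of truncated subtraction.\<close>
  define P where "P t = E (t + Suc i)" for t
  have "P (Suc t) = [:1, - (q ^ Suc i * q ^ t):] * P t" for t
  proof -
    have "P (Suc t) = (\<Prod>s<Suc (a + t). [:1, - (q powi (int (Suc t + Suc i) - 1 - int s)):])"
      by (simp add: P_def E_def)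
    also have "\<dots> = [:1, - (q powi (int (t + Suc i))):] * (\<Prod>s<a + t. [:1, - (q powi (int (t + Suc i) - 1 - int s)):])"
      unfolding prod.lessThan_Suc_shift
      by (intro arg_cong2[of _ _ _ _ "(*)"] prod.cong refl) (simp_all add: algebra_simps)
    also have "\<dots> = [:1, - (q ^ Suc i * q ^ t):] * P t"
      unfolding P_def E_def power_int_of_nat by (simp add: power_add mult_ac)
    finally show ?thesis .
  qed
  hence conv: "convergent (\<lambda>N. poly.coeff (E N) r)" for r
    using convergent_coeff_product[OF assms(1), of P "q ^ Suc i" r]
    unfolding P_def by (subst convergent_ignore_initial_segment[of _ "Suc i", symmetric]) simp
  have "\<forall>\<^sub>F N in sequentially. poly.coeff (shifted_power (\<lambda>i. q powi (int N - 1 - int i)) (a + N - 1 - i)) (b + N - 1 - j) =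
      (if b + i \<le> a + j then poly.coeff (E N) (a + j - (b + i)) else 0)"
  proof (rule eventually_sequentiallyI[of "i + j + 1"])
    fix N assume "i + j + 1 \<le> N"
    hence "(b + N - 1 - j \<le> a + N - 1 - i) = (b + i \<le> a + j)" "a + N - 1 - i - (b + N - 1 - j) = a + j - (b + i)"
      by auto
    thus "poly.coeff (shifted_power (\<lambda>i. q powi (int N - 1 - int i)) (a + N - 1 - i)) (b + N - 1 - j) =
      (if b + i \<le> a + j then poly.coeff (E N) (a + j - (b + i)) else 0)"
      unfolding coeff_shifted_power E_def by simp
  qed
  moreover have "convergent (\<lambda>N. if b + i \<le> a + j then poly.coeff (E N) (a + j - (b + i)) else 0)"
    using conv by (cases "b + i \<le> a + j") (simp_all add: convergent_const)
  ultimately show ?thesis using convergent_cong by fast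
qed

text \<open>A coefficientwise limit, the uniform degree bound and uniqueness of limits together
  discharge the definite description in \<open>I_A\<close>.\<close>

lemma I_A_converges:
  assumes "norm q < 1" "q \<noteq> 0" "is_partition mu"
  shows "sym_converges (part_length mu) (\<lambda>N. interp_schur N (\<lambda>i. q powi (int N - 1 - int i)) mu) (I_A q mu)"
proof -
  define F where "F N = interp_schur N (\<lambda>i. q powi (int N - 1 - int i)) mu" for N
  have "convergent (\<lambda>N. Poly_Mapping.lookup (F N) m)" for m
  proof -
    define A where "A N n k = poly.coeff (shifted_power (\<lambda>i. q powi (int N - 1 - int i)) n) k" for N n k
    define Y where "Y nu i j = lim (\<lambda>N. A N (mu i + N - 1 - i) (nu j + N - 1 - j))" for nu i j
    have Y: "(\<lambda>N. A N (mu i + N - 1 - i) (nu j + N - 1 - j)) \<longlonglongrightarrow> Y nu i j" for nu i j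
      using convergent_coeff_shifted_power[OF assms(1,2)] unfolding A_def Y_def convergent_LIMSEQ_iff .
    define S where "S N = (\<Sum>nu | is_partition nu \<and> part_subset nu mu.
        detn (part_length mu) (\<lambda>i j. A N (mu i + N - 1 - i) (nu j + N - 1 - j)) *
        Poly_Mapping.lookup (schur N nu) m)" for N
    have "convergent S"
      unfolding S_def
      by (intro convergent_sum convergent_mult lookup_schur_convergent convergentI[OF tendsto_detn[OF Y]]) auto
    moreover have "\<forall>\<^sub>F N in sequentially. Poly_Mapping.lookup (F N) m = S N"
      using eventually_ge_at_top[of "part_length mu"]
    proof eventually_elim
      case (elim N)
      show ?case
        unfolding S_def F_def interp_schur_def A_def
        by (rule lookup_det_quotient_schur[OF assms(3) elim]) (rule degree_shifted_power lead_coeff_shifted_power)+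
    qed
    ultimately show ?thesis using convergent_cong by fast
  qed
  then obtain G where "\<And>m. (\<lambda>N. Poly_Mapping.lookup (F N) m) \<longlonglongrightarrow> G m"
    unfolding convergent_def by metis
  moreover have "F N \<in> SymN_le (part_size mu) N" if "N \<ge> part_length mu" for N
    unfolding F_def interp_schur_def
    by (rule det_quotient_SymN_le[OF assms(3) that]) (rule degree_shifted_power lead_coeff_shifted_power)+
  ultimately have G: "sym_converges (part_length mu) F G" by (intro sym_convergesI)
  have "(THE F'. sym_converges (part_length mu) F F') = G"
    using G sym_converges_unique[OF _ G] by (rule the_equality)
  thus ?thesis using G unfolding I_A_def F_def by simp
qed

lemma scale_vars_interp_schur:
  assumes "c \<noteq> 0"
  shows "scale_vars c (interp_schur N cs mu) = Const (\<Prod>i<N. c ^ mu i) * interp_schur N (\<lambda>i. cs i / c) mu"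
  unfolding interp_schur_def
proof (rule scale_vars_det_quotient)
  fix k
  have "poly (pcompose (shifted_power cs k) [:0, c:]) x = poly (smult (c ^ k) (shifted_power (\<lambda>i. cs i / c) k)) x" for x
  proof -
    have "poly (pcompose (shifted_power cs k) [:0, c:]) x = (\<Prod>i<k. c * (x - cs i / c))"
      using assms by (auto simp: poly_pcompose shifted_power_def poly_prod field_simps intro!: prod.cong)
    thus ?thesis by (simp add: prod.distrib shifted_power_def poly_prod)
  qed
  thus "pcompose (shifted_power cs k) [:0, c:] = smult (c ^ k) (shifted_power (\<lambda>i. cs i / c) k)"
    by (simp add: poly_eq_poly_eq_iff[symmetric] fun_eq_iff)
qed fact

subsection \<open>Univariate Al-Salam--Carlitz polynomials\<close>

lemma qpoch_Suc: "qpoch x q (Suc n) = qpoch x q n * (1 - x * q ^ n)"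
  by (simp add: qpoch_def)

lemma qpoch_nonzero:
  assumes "\<And>n. q ^ Suc n \<noteq> 1" shows "qpoch q q n \<noteq> 0"
  using assms by (auto simp: qpoch_def)

text \<open>A q-binomial coefficient with a prefactor: solving \<open>asc_coeff_rec\<close>
  downwards from the value 1 at \<open>k = n\<close> collects \<open>-1/d\<close> and the powers of
  \<open>q\<close> with exponents \<open>- k, ..., -(n - 1)\<close>, whose sum is
  \<open>C(k,2) - C(n,2)\<close>.\<close>

definition asc_coeff :: "complex \<Rightarrow> complex \<Rightarrow> nat \<Rightarrow> nat \<Rightarrow> complex" where
  "asc_coeff q d n k = (if k \<le> n then
     (- 1 / d) ^ (n - k) * (q ^ (k choose 2) / q ^ (n choose 2)) *
       (qpoch q q n / (qpoch q q k * qpoch q q (n - k))) else 0)"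

lemma asc_coeff_self:
  assumes "\<And>n. q ^ Suc n \<noteq> 1" "q \<noteq> 0" shows "asc_coeff q d n n = 1"
  using qpoch_nonzero[OF assms(1)] assms(2) by (simp add: asc_coeff_def qpoch_def[of _ _ 0])

text \<open>This is the comparison of the coefficients of the \<open>k\<close>-th shifted power in
  the eigenvalue equation, divided by \<open>c\<close>.\<close>

lemma asc_coeff_rec:
  assumes "\<And>n. q ^ Suc n \<noteq> 1" "q \<noteq> 0" "d \<noteq> 0" "k < n"
  shows "d * (q ^ n - q ^ k) * asc_coeff q d n k = (1 - q ^ Suc k) * asc_coeff q d n (Suc k)"
proof -
  define m where "m = n - Suc k"
  have n: "n = k + Suc m" using assms(4) by (simp add: m_def)
  have nz: "qpoch q q i \<noteq> 0" "1 - q ^ Suc i \<noteq> 0" for i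
    using qpoch_nonzero[OF assms(1)] assms(1)[of i] by auto
  have ch: "q ^ (Suc k choose 2) = q ^ (k choose 2) * q ^ k"
    by (simp add: numeral_2_eq_2 power_add)
  have q: "d * (q ^ n - q ^ k) = - d * q ^ k * (1 - q ^ Suc m)"
    by (simp add: n power_add algebra_simps)
  show ?thesis
    using nz(1)[of k] nz(1)[of m] nz(1)[of n] nz(2)[of k] nz(2)[of m] assms(2,3)
    unfolding q asc_coeff_def ch
    by (simp add: n qpoch_Suc[of q q k] qpoch_Suc[of q q m] ch)
qed

lemma poly_shifted_power_Suc:
  "poly (shifted_power cs (Suc n)) x = poly (shifted_power cs n) x * (x - cs n)"
  by (simp add: shifted_power_def poly_prod algebra_simps)

text \<open>The zeros of \<open>g_k(q x)\<close> are the nodes with indices 1 to \<open>k\<close>.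
  The factor \<open>c x - 1\<close> supplies node 0, and node \<open>k\<close> is left over on the
  right.\<close>

lemma shifted_power_scale_up:
  assumes "c \<noteq> 0" "q \<noteq> 0"
  shows "(c * x - 1) * poly (shifted_power (\<lambda>i. 1 / (c * q ^ i)) k) (q * x) =
    (q ^ k * c * x - 1) * poly (shifted_power (\<lambda>i. 1 / (c * q ^ i)) k) x"
proof (induction k)
  case 0 thus ?case by (simp add: shifted_power_def)
next
  case (Suc k)
  let ?g = "\<lambda>k. poly (shifted_power (\<lambda>i. 1 / (c * q ^ i)) k)"
  have "(c * x - 1) * ?g (Suc k) (q * x) = ((c * x - 1) * ?g k (q * x)) * (q * x - 1 / (c * q ^ k))"
    by (simp add: poly_shifted_power_Suc mult_ac)
  also have "\<dots> = ?g k x * ((q ^ k * c * x - 1) * (q * x - 1 / (c * q ^ k)))"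
    by (simp add: Suc mult_ac)
  also have "(q ^ k * c * x - 1) * (q * x - 1 / (c * q ^ k)) = (x - 1 / (c * q ^ k)) * (q ^ Suc k * c * x - 1)"
    using assms by (simp add: field_simps)
  finally show ?case by (simp add: poly_shifted_power_Suc mult_ac)
qed

text \<open>The opposite dilation moves the nodes back by one: the new zero is \<open>q/c\<close>,
  and the others are the first \<open>k\<close> nodes.\<close>

lemma shifted_power_scale_down:
  assumes "c \<noteq> 0" "q \<noteq> 0"
  shows "poly (shifted_power (\<lambda>i. 1 / (c * q ^ i)) (Suc k)) (inverse q * x) =
    (x - q / c) * poly (shifted_power (\<lambda>i. 1 / (c * q ^ i)) k) x / q ^ Suc k"
proof (induction k)
  case 0 thus ?case using assms by (simp add: shifted_power_def field_simps)
next
  case (Suc k)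
  let ?g = "\<lambda>k. poly (shifted_power (\<lambda>i. 1 / (c * q ^ i)) k)"
  have "?g (Suc (Suc k)) (inverse q * x) = ?g (Suc k) (inverse q * x) * (inverse q * x - 1 / (c * q ^ Suc k))"
    by (rule poly_shifted_power_Suc)
  also have "\<dots> = (x - q / c) * ?g k x / q ^ Suc k * ((x - 1 / (c * q ^ k)) / q)"
    unfolding Suc using assms by (simp add: field_simps)
  also have "\<dots> = (x - q / c) * ?g (Suc k) x / q ^ Suc (Suc k)"
    by (simp add: poly_shifted_power_Suc[of _ k] mult_ac)
  finally show ?case .
qed

text \<open>\<open>(c - 1/x)(T_q - 1)\<close> acts on the shifted power as a scalar. Multiplying by
  \<open>d - 1/x\<close> leaves a term with a pole, whose singular part is exactly cancelled by the
  \<open>T_(1/q)\<close> term; a multiple of the preceding shifted power remains.\<close>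

lemma D_ASC_shifted_power:
  assumes "c \<noteq> 0" "q \<noteq> 0" "x \<noteq> 0"
  shows "D_ASC q c d (poly (shifted_power (\<lambda>i. 1 / (c * q ^ i)) (Suc k))) x =
    c * d * (q ^ Suc k - 1) * poly (shifted_power (\<lambda>i. 1 / (c * q ^ i)) (Suc k)) x +
    c * (1 - q ^ Suc k) * poly (shifted_power (\<lambda>i. 1 / (c * q ^ i)) k) x"
proof -
  let ?g = "\<lambda>k. poly (shifted_power (\<lambda>i. 1 / (c * q ^ i)) k)"
  define G where "G = ?g k x"
  have g: "?g (Suc k) x = (x - 1 / (c * q ^ k)) * G"
    by (simp add: poly_shifted_power_Suc G_def mult_ac)
  have "(c - 1 / x) * (?g (Suc k) (q * x) - ?g (Suc k) x) =
      ((c * x - 1) * ?g (Suc k) (q * x) - (c * x - 1) * ?g (Suc k) x) / x"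
    using assms(3) by (simp add: field_simps)
  also have "\<dots> = c * (q ^ Suc k - 1) * ?g (Suc k) x"
    unfolding shifted_power_scale_up[OF assms(1,2)] using assms(3) by (simp add: field_simps)
  finally have 1: "(c - 1 / x) * (?g (Suc k) (q * x) - ?g (Suc k) x) = c * (q ^ Suc k - 1) * ?g (Suc k) x" .
  have 2: "?g (Suc k) (inverse q * x) - ?g (Suc k) x = x * (1 / q ^ Suc k - 1) * G"
    unfolding shifted_power_scale_down[OF assms(1,2)] g G_def[symmetric]
    using assms by (simp add: field_simps)
  have "D_ASC q c d (?g (Suc k)) x =
      (d - 1 / x) * ((c - 1 / x) * (?g (Suc k) (q * x) - ?g (Suc k) x)) +
      q / x ^ 2 * (?g (Suc k) (inverse q * x) - ?g (Suc k) x)"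
    by (simp add: D_ASC_def mult_ac)
  also have "\<dots> = c * d * (q ^ Suc k - 1) * ?g (Suc k) x +
      (q / x * (1 / q ^ Suc k - 1) * G - c * (q ^ Suc k - 1) * ?g (Suc k) x / x)"
    unfolding 1 2 using assms(3) by (simp add: field_simps power2_eq_square)
  also have "q / x * (1 / q ^ Suc k - 1) * G - c * (q ^ Suc k - 1) * ?g (Suc k) x / x = c * (1 - q ^ Suc k) * G"
    unfolding g using assms by (simp add: field_simps)
  finally show ?thesis unfolding G_def .
qed

lemma D_ASC_sum:
  "D_ASC q c d (\<lambda>x. \<Sum>k\<in>K. a k * f k x) x = (\<Sum>k\<in>K. a k * D_ASC q c d (f k) x)"
  by (simp add: D_ASC_def sum_distrib_left sum_subtractf[symmetric] sum.distrib[symmetric] algebra_simps)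

definition asc_sum :: "complex \<Rightarrow> complex \<Rightarrow> complex \<Rightarrow> nat \<Rightarrow> complex poly" where
  "asc_sum q c d n = (\<Sum>k\<le>n. smult (asc_coeff q d n k) (shifted_power (\<lambda>i. 1 / (c * q ^ i)) k))"

lemma asc_sum_eigen:
  assumes q: "\<And>n. q ^ Suc n \<noteq> 1" "q \<noteq> 0" and cd: "c \<noteq> 0" "d \<noteq> 0" and x: "x \<noteq> 0"
  shows "D_ASC q c d (poly (asc_sum q c d n)) x = c * d * (q ^ n - 1) * poly (asc_sum q c d n) x"
proof -
  define g where "g k = poly (shifted_power (\<lambda>i. 1 / (c * q ^ i)) k)" for k
  define a where "a = asc_coeff q d n"
  have D0: "D_ASC q c d (g 0) x = 0"
    by (simp add: D_ASC_def g_def shifted_power_def)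
  have DS: "D_ASC q c d (g (Suc k)) x = c * d * (q ^ Suc k - 1) * g (Suc k) x + c * (1 - q ^ Suc k) * g k x" for k
    unfolding g_def by (rule D_ASC_shifted_power[OF cd(1) q(2) x])
  have p: "poly (asc_sum q c d n) = (\<lambda>x. \<Sum>k\<le>n. a k * g k x)"
    by (simp add: asc_sum_def g_def a_def poly_sum fun_eq_iff)
  have rec: "a (Suc k) * (c * (1 - q ^ Suc k)) = a k * (c * d * (q ^ n - q ^ k))" if "k < n" for k
    using arg_cong[OF asc_coeff_rec[OF q cd(2) that], of "(*) c"] by (simp only: a_def mult_ac)
  have "D_ASC q c d (poly (asc_sum q c d n)) x = (\<Sum>k\<le>n. a k * D_ASC q c d (g k) x)"
    unfolding p by (rule D_ASC_sum)
  also have "\<dots> = (\<Sum>k<n. a (Suc k) * D_ASC q c d (g (Suc k)) x)"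
    by (simp add: sum.atMost_shift D0)
  also have "\<dots> = (\<Sum>k<n. c * d * (q ^ Suc k - 1) * (a (Suc k) * g (Suc k) x)) +
      (\<Sum>k<n. a (Suc k) * (c * (1 - q ^ Suc k)) * g k x)"
    by (simp add: DS sum.distrib[symmetric] algebra_simps)
  \<comment> \<open>The added term \<open>k = 0\<close> vanishes because of
    \<open>q ^ 0 - 1\<close>.\<close>
  also have "(\<Sum>k<n. c * d * (q ^ Suc k - 1) * (a (Suc k) * g (Suc k) x)) =
      (\<Sum>k\<le>n. c * d * (q ^ k - 1) * (a k * g k x))"
    by (simp add: sum.atMost_shift)
  \<comment> \<open>The added term \<open>k = n\<close> vanishes because of
    \<open>q ^ n - q ^ n\<close>, so both sums now run over \<open>k \<le> n\<close> and their
    factors add up to the eigenvalue.\<close>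
  also have "(\<Sum>k<n. a (Suc k) * (c * (1 - q ^ Suc k)) * g k x) =
      (\<Sum>k\<le>n. a k * (c * d * (q ^ n - q ^ k)) * g k x)"
    by (simp add: rec lessThan_Suc_atMost[symmetric] del: power_Suc)
  finally show ?thesis
    unfolding p by (simp add: sum_distrib_left sum.distrib[symmetric] algebra_simps)
qed

lemma asc_sum_monic:
  assumes "\<And>n. q ^ Suc n \<noteq> 1" "q \<noteq> 0"
  shows "Polynomial.degree (asc_sum q c d n) = n" "lead_coeff (asc_sum q c d n) = 1"
proof -
  have le: "Polynomial.degree (asc_sum q c d n) \<le> n"
    unfolding asc_sum_def
    by (intro degree_sum_le) (auto intro!: order.trans[OF degree_smult_le] simp: degree_shifted_power)
  have "poly.coeff (asc_sum q c d n) n =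
      (\<Sum>k\<in>{n}. asc_coeff q d n k * poly.coeff (shifted_power (\<lambda>i. 1 / (c * q ^ i)) k) n)"
    unfolding asc_sum_def coeff_sum coeff_smult
    by (rule sum.mono_neutral_right) (auto intro!: coeff_eq_0 simp: degree_shifted_power)
  also have "\<dots> = 1"
    using lead_coeff_shifted_power[of "\<lambda>i. 1 / (c * q ^ i)" n]
    by (simp add: degree_shifted_power asc_coeff_self[OF assms])
  finally have one: "poly.coeff (asc_sum q c d n) n = 1" .
  hence "n \<le> Polynomial.degree (asc_sum q c d n)" by (intro le_degree) simp
  with le show deg: "Polynomial.degree (asc_sum q c d n) = n" by simp
  show "lead_coeff (asc_sum q c d n) = 1" using one by (simp add: deg)
qed

text \<open>The eigenvalue is read off from the leading coefficient, so it fixes the degree when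
  \<open>q\<close> is not a root of unity. In \<open>ASC_poly_eq\<close> this excludes a nonzero
  difference of two monic solutions, which would have smaller degree.\<close>

lemma D_ASC_eigen_degree:
  assumes "q \<noteq> 0" "c \<noteq> 0" "d \<noteq> 0" "r \<noteq> 0"
    and eigen: "\<And>x. x \<noteq> 0 \<Longrightarrow> D_ASC q c d (poly r) x = c * d * (e - 1) * poly r x"
  shows "q ^ Polynomial.degree r = e"
proof -
  define k where "k = Polynomial.degree r"
  define s where "s = pcompose r [:0, q:] - r"
  define t where "t = pcompose r [:0, inverse q:] - r"
  \<comment> \<open>This is \<open>x^2\<close> times the eigenvalue equation with its denominators
    cleared. At degree \<open>k + 2\<close> only the part \<open>c d x^2 (T_q - 1)\<close> and the
    eigenvalue term contribute.\<close>
  define P where "P = [:1, - (c + d), c * d:] * s + smult q t - smult (c * d * (e - 1)) (monom 1 2 * r)"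
  have "poly P x = 0" if "x \<noteq> 0" for x
  proof -
    have "poly P x = x ^ 2 * (D_ASC q c d (poly r) x - c * d * (e - 1) * poly r x)"
      using that unfolding P_def s_def t_def D_ASC_def
      by (simp add: poly_pcompose poly_monom field_simps power2_eq_square)
    thus ?thesis using eigen[OF that] by simp
  qed
  hence "- {0} \<subseteq> {x. poly P x = 0}" by auto
  moreover have "infinite (- {0 :: complex})"
    using infinite_UNIV_char_0 by (simp add: Compl_eq_Diff_UNIV)
  ultimately have "P = 0" using poly_roots_finite[of P] finite_subset by blast
  hence "poly.coeff P (Suc (Suc k)) = 0" by simp
  moreover have r0: "poly.coeff r (Suc k) = 0" "poly.coeff r (Suc (Suc k)) = 0"
    by (simp_all add: k_def coeff_eq_0)
  have st: "poly.coeff s i = (q ^ i - 1) * poly.coeff r i" "poly.coeff t i = (inverse q ^ i - 1) * poly.coeff r i" for i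
    by (simp_all add: s_def t_def coeff_pcompose_linear algebra_simps)
  have "poly.coeff P (Suc (Suc k)) = c * d * ((q ^ k - 1) - (e - 1)) * poly.coeff r k"
    by (simp add: P_def st r0 coeff_monom_mult) (simp add: algebra_simps)
  moreover have "poly.coeff r k \<noteq> 0" using assms(4) by (simp add: k_def)
  ultimately show ?thesis using assms(2,3) by (simp add: k_def)
qed

lemma ASC_poly_eq:
  assumes q: "\<And>n. q ^ Suc n \<noteq> 1" "q \<noteq> 0" and cd: "c \<noteq> 0" "d \<noteq> 0"
  shows "ASC_poly q c d n = asc_sum q c d n"
  unfolding ASC_poly_def
proof (rule the_equality)
  fix p
  assume p: "Polynomial.degree p = n \<and> lead_coeff p = 1 \<and>
      (\<forall>x. x \<noteq> 0 \<longrightarrow> D_ASC q c d (poly p) x = c * d * (q ^ n - 1) * poly p x)"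
  define r where "r = p - asc_sum q c d n"
  have "r = 0"
  proof (rule ccontr)
    assume "r \<noteq> 0"
    have "D_ASC q c d (poly r) x = c * d * (q ^ n - 1) * poly r x" if "x \<noteq> 0" for x
    proof -
      have "D_ASC q c d (poly r) x = D_ASC q c d (poly p) x - D_ASC q c d (poly (asc_sum q c d n)) x"
        by (simp add: D_ASC_def r_def algebra_simps)
      thus ?thesis using p that asc_sum_eigen[OF q cd that] by (simp add: r_def algebra_simps)
    qed
    hence eq: "q ^ Polynomial.degree r = q ^ n"
      by (rule D_ASC_eigen_degree[OF q(2) cd \<open>r \<noteq> 0\<close>])
    have "Polynomial.degree r \<le> n"
      unfolding r_def using p asc_sum_monic(1)[OF q] by (intro degree_diff_le) auto
    moreover have "poly.coeff r n = 0"
      using p asc_sum_monic[OF q, of c d n] by (auto simp: r_def)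
    hence "Polynomial.degree r \<noteq> n" using \<open>r \<noteq> 0\<close> by (metis leading_coeff_0_iff)
    ultimately obtain j where "n = Polynomial.degree r + Suc j"
      by (metis add_Suc_right less_imp_Suc_add order_le_neq_trans)
    hence "q ^ Suc j = 1" using eq q(2) by (simp add: power_add)
    thus False using q(1) by blast
  qed
  thus "p = asc_sum q c d n" by (simp add: r_def)
qed (use asc_sum_monic[OF q] asc_sum_eigen[OF q cd] in auto)

subsection \<open>Limit of the expansion coefficients\<close>

lemma qpoch_ratio_tendsto:
  assumes "norm q < 1" "\<And>n. q ^ Suc n \<noteq> 1"
  shows "(\<lambda>k. qpoch q q (k + s) / qpoch q q k) \<longlonglongrightarrow> 1"
proof (induction s)
  case 0
  thus ?case using qpoch_nonzero[OF assms(2)] by simp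
next
  case (Suc s)
  have "(\<lambda>k. q ^ (k + Suc s)) \<longlonglongrightarrow> 0"
    using LIMSEQ_ignore_initial_segment[OF LIMSEQ_power_zero[OF assms(1)], of "Suc s"] .
  hence "(\<lambda>k. qpoch q q (k + s) / qpoch q q k * (1 - q ^ (k + Suc s))) \<longlonglongrightarrow> 1 * (1 - 0)"
    by (intro tendsto_mult Suc tendsto_diff tendsto_const)
  thus ?case by (simp add: qpoch_Suc)
qed

lemma prod_power_int:
  fixes x :: "'a::field"
  assumes "x \<noteq> 0"
  shows "(\<Prod>i\<in>I. x powi f i) = x powi (\<Sum>i\<in>I. f i)"
  using assms by (induction I rule: infinite_finite_induct) (simp_all add: power_int_add)

text \<open>The exponent of \<open>q\<close> is \<open>-(a-i)(a-i-1)/2\<close>, that is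
  \<open>-C(a-i,2)\<close>, written out because \<open>a - i\<close> may be negative. The cross term
  \<open>i a\<close> and the term \<open>C(a,2)\<close> later sum to the two partition
  statistics.\<close>

definition asc_weight :: "complex \<Rightarrow> complex \<Rightarrow> nat \<Rightarrow> nat \<Rightarrow> complex" where
  "asc_weight q d a i = (- 1 / d) powi (int a - int i) *
     q powi (int i * int a - int (a choose 2) - int (Suc i choose 2))"

lemma choose_2_int: "2 * int (n choose 2) = int n * (int n - 1)"
  by (induction n) (simp_all add: numeral_2_eq_2 algebra_simps)

text \<open>With \<open>n = N - 1 + (a - i)\<close>, the doubled left side
  \<open>n (2N - 1 - n)\<close> equals \<open>N(N-1) - (a-i)(a-i-1)\<close>. Thus \<open>N\<close>
  contributes an additive constant, which drops out of ratios.\<close>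

lemma choose_2_shift:
  assumes "i < N"
  shows "(int N - 1) * int (a + N - 1 - i) - int ((a + N - 1 - i) choose 2) =
    int (N choose 2) + (int i * int a - int (a choose 2) - int (Suc i choose 2))"
proof -
  have n: "int (a + N - 1 - i) = int a + int N - 1 - int i" using assms by simp
  have "2 * ((int N - 1) * int (a + N - 1 - i) - int ((a + N - 1 - i) choose 2)) =
    2 * (int (N choose 2) + (int i * int a - int (a choose 2) - int (Suc i choose 2)))"
    unfolding right_diff_distrib distrib_left choose_2_int n by (simp add: algebra_simps)
  thus ?thesis by simp
qed

lemma asc_coeff_shift:
  assumes "q \<noteq> 0" "d \<noteq> 0" "i < N" "j < N" "b + N - 1 - j \<le> a + N - 1 - i"
  shows "asc_coeff q (d * q powi (1 - int N)) (a + N - 1 - i) (b + N - 1 - j) =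
    asc_weight q d a i / asc_weight q d b j *
    (qpoch q q (a + N - 1 - i) / (qpoch q q (b + N - 1 - j) * qpoch q q (a + N - 1 - i - (b + N - 1 - j))))"
proof -
  \<comment> \<open>at \<open>n = a + N - 1 - i\<close> this depends on \<open>N\<close> only through a factor free of \<open>a\<close> and \<open>i\<close>\<close>
  define W where "W n = (- 1 / d) powi int n * q powi ((int N - 1) * int n - int (n choose 2))" for n
  define n where "n = a + N - 1 - i"
  define k where "k = b + N - 1 - j"
  have W: "W (a + N - 1 - i) = (- 1 / d) powi (int N - 1) * q powi int (N choose 2) * asc_weight q d a i"
    if "i < N" for a i
  proof -
    have "int (a + N - 1 - i) = (int N - 1) + (int a - int i)" using that by simp
    thus ?thesis
      unfolding W_def choose_2_shift[OF that] asc_weight_def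
      using assms(1,2) by (simp add: power_int_add)
  qed
  have nz: "(- 1 / d) powi e \<noteq> 0" "q powi e \<noteq> 0" for e
    using assms(1,2) by simp_all
  have e: "int n - int k = int (n - k)" using assms(5) by (simp add: n_def k_def del: One_nat_def)
  have "- 1 / (d * q powi (1 - int N)) = (- 1 / d) * q powi (int N - 1)"
    using assms(1,2) by (simp add: power_int_diff field_simps)
  hence "(- 1 / (d * q powi (1 - int N))) ^ (n - k) = (- 1 / d) powi (int n - int k) * q powi ((int N - 1) * (int n - int k))"
    unfolding e by (simp only: power_int_mult power_int_of_nat power_mult_distrib)
  moreover have "q ^ (k choose 2) / q ^ (n choose 2) = q powi (int (k choose 2) - int (n choose 2))"
    using assms(1) by (simp add: power_int_diff)
  ultimately have "(- 1 / (d * q powi (1 - int N))) ^ (n - k) * (q ^ (k choose 2) / q ^ (n choose 2)) =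
      (- 1 / d) powi (int n - int k) *
      q powi ((int N - 1) * (int n - int k) + (int (k choose 2) - int (n choose 2)))"
    using assms(1) by (simp add: power_int_add)
  also have "(int N - 1) * (int n - int k) + (int (k choose 2) - int (n choose 2)) =
      ((int N - 1) * int n - int (n choose 2)) - ((int N - 1) * int k - int (k choose 2))"
    by (simp add: algebra_simps)
  also have "(- 1 / d) powi (int n - int k) * q powi \<dots> = W n / W k"
    unfolding W_def power_int_diff[OF disjI1[OF assms(1)], of "(int N - 1) * int n - int (n choose 2)"]
    using assms(2) by (simp add: power_int_diff)
  also have "\<dots> = asc_weight q d a i / asc_weight q d b j"
    unfolding n_def k_def W[OF assms(3)] W[OF assms(4)] using assms(1,2) by simp
  finally show ?thesis
    using assms(5) by (simp add: asc_coeff_def n_def k_def)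
qed

text \<open>The difference of degree and index is eventually the constant
  \<open>a + j - b - i\<close>. If it is nonnegative, a ratio of Pochhammer symbols tending to 1
  splits off; if negative, the entry is eventually 0, matching the convention of
  \<open>sigma_entry\<close>.\<close>

lemma asc_coeff_tendsto:
  assumes "norm q < 1" "q \<noteq> 0" "\<And>n. q ^ Suc n \<noteq> 1" "d \<noteq> 0"
  shows "(\<lambda>N. asc_coeff q (d * q powi (1 - int N)) (a + N - 1 - i) (b + N - 1 - j)) \<longlonglongrightarrow>
    asc_weight q d a i / asc_weight q d b j * sigma_entry q (int a - int i - int b + int j)"
proof (cases "b + i \<le> a + j")
  case True
  define s where "s = a + j - (b + i)"
  have "filterlim (\<lambda>N. b + N - 1 - j) at_top sequentially"
    by (rule filterlim_at_top_mono[OF filterlim_minus_const_nat_at_top[of "Suc j"]]) (auto intro!: always_eventually)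
  hence "(\<lambda>N. qpoch q q (b + N - 1 - j + s) / qpoch q q (b + N - 1 - j)) \<longlonglongrightarrow> 1"
    by (rule filterlim_compose[OF qpoch_ratio_tendsto[OF assms(1,3)]])
  hence lim: "(\<lambda>N. asc_weight q d a i / asc_weight q d b j * (qpoch q q (b + N - 1 - j + s) / qpoch q q (b + N - 1 - j) * (1 / qpoch q q s)))
      \<longlonglongrightarrow> asc_weight q d a i / asc_weight q d b j * (1 * (1 / qpoch q q s))"
    by (intro tendsto_mult tendsto_const)
  have "int a - int i - int b + int j = int s" using True by (simp add: s_def)
  hence entry: "sigma_entry q (int a - int i - int b + int j) = 1 * (1 / qpoch q q s)"
    by (simp add: sigma_entry_def)
  have "\<forall>\<^sub>F N in sequentially. asc_weight q d a i / asc_weight q d b j * (qpoch q q (b + N - 1 - j + s) / qpoch q q (b + N - 1 - j) * (1 / qpoch q q s))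
     = asc_coeff q (d * q powi (1 - int N)) (a + N - 1 - i) (b + N - 1 - j)"
  proof (rule eventually_sequentiallyI[of "i + j + 1"])
    fix N assume N: "i + j + 1 \<le> N"
    have n: "a + N - 1 - i = b + N - 1 - j + s" using N True by (simp add: s_def)
    show "asc_weight q d a i / asc_weight q d b j * (qpoch q q (b + N - 1 - j + s) / qpoch q q (b + N - 1 - j) * (1 / qpoch q q s))
     = asc_coeff q (d * q powi (1 - int N)) (a + N - 1 - i) (b + N - 1 - j)"
      by (subst asc_coeff_shift) (use assms N n in \<open>auto simp del: One_nat_def\<close>)
  qed
  from Lim_transform_eventually[OF lim this] show ?thesis by (simp only: entry)
next
  case False
  hence "sigma_entry q (int a - int i - int b + int j) = 0" by (simp add: sigma_entry_def)
  moreover have "\<forall>\<^sub>F N in sequentially. asc_coeff q (d * q powi (1 - int N)) (a + N - 1 - i) (b + N - 1 - j) = 0"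
    by (rule eventually_sequentiallyI[of "i + j + 1"]) (use False in \<open>auto simp: asc_coeff_def\<close>)
  ultimately show ?thesis using tendsto_eventually by fastforce
qed

section \<open>Partition statistics and the normalisation of \<open>sigma_ASC\<close>\<close>

lemma part_n_eq:
  assumes "is_partition lam" "part_length lam \<le> l"
  shows "part_n lam = (\<Sum>i<l. i * lam i)"
  unfolding part_n_def partition_support[OF assms(1)] using assms(2)
  by (intro sum.mono_neutral_left) (auto simp: partition_eq_0[OF assms(1)])

text \<open>Double counting: \<open>j\<close> is counted once for each row longer than
  \<open>j\<close>, so a row of length \<open>r\<close> contributes
  \<open>0 + ... + (r - 1)\<close>.\<close>

lemma part_n_transpose_eq:
  assumes "is_partition lam" "part_length lam \<le> l"
  shows "part_n (part_transpose lam) = (\<Sum>i<l. lam i choose 2)"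
proof -
  have set: "{i. j < lam i} = {i \<in> {..<l}. j < lam i}" for j
    using partition_eq_0[OF assms(1)] assms(2) by (auto simp: not_le intro: ccontr)
  have "{j. part_transpose lam j \<noteq> 0} \<subseteq> {..<lam 0}"
  proof
    fix j assume "j \<in> {j. part_transpose lam j \<noteq> 0}"
    then obtain i where "j < lam i" by (auto simp: part_transpose_def card_eq_0_iff)
    thus "j \<in> {..<lam 0}" using partition_mono[OF assms(1), of 0 i] by simp
  qed
  hence "part_n (part_transpose lam) = (\<Sum>j<lam 0. j * part_transpose lam j)"
    unfolding part_n_def by (intro sum.mono_neutral_left) auto
  also have "\<dots> = (\<Sum>j<lam 0. \<Sum>i<l. if j < lam i then j else 0)"
    by (simp add: part_transpose_def set sum.If_cases Int_def mult.commute)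
  also have "\<dots> = (\<Sum>i<l. \<Sum>j<lam 0. if j < lam i then j else 0)"
    by (rule sum.swap)
  also have "\<dots> = (\<Sum>i<l. lam i choose 2)"
  proof (rule sum.cong[OF refl])
    fix i
    have "(\<Sum>j<lam 0. if j < lam i then j else 0) = (\<Sum>j<lam i. j)"
      using partition_mono[OF assms(1), of 0 i] by (intro sum.mono_neutral_cong_right) auto
    also have "(\<Sum>j<n. j) = n choose 2" for n :: nat
      by (induction n) (simp_all add: numeral_2_eq_2)
    finally show "(\<Sum>j<lam 0. if j < lam i then j else 0) = lam i choose 2" .
  qed
  finally show ?thesis .
qed

text \<open>At equal index \<open>i\<close> the contributions of \<open>i\<close> alone cancel,
  leaving only terms that sum to sizes and statistics of partitions.\<close>

lemma asc_weight_ratio: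
  assumes "q \<noteq> 0" "d \<noteq> 0"
  shows "asc_weight q d a i / asc_weight q d b i = (- 1 / d) powi (int a - int b) *
    q powi (int (i * a) - int (a choose 2) - (int (i * b) - int (b choose 2)))"
proof -
  have nz: "- 1 / d \<noteq> 0" using assms(2) by simp
  have "asc_weight q d a i / asc_weight q d b i =
      (- 1 / d) powi ((int a - int i) - (int b - int i)) *
      q powi ((int i * int a - int (a choose 2) - int (Suc i choose 2)) -
              (int i * int b - int (b choose 2) - int (Suc i choose 2)))"
    unfolding power_int_diff[OF disjI1[OF nz], of "int a - int i"]
      power_int_diff[OF disjI1[OF assms(1)], of "int i * int a - int (a choose 2) - int (Suc i choose 2)"]
    by (simp add: asc_weight_def)
  thus ?thesis by (simp add: algebra_simps)
qed

lemma sigma_ASC_eq: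
  assumes "q \<noteq> 0" "c \<noteq> 0" "d \<noteq> 0" "is_partition lam" "is_partition mu" "part_subset mu lam"
  shows "sigma_ASC q c d lam mu = inverse (c ^ part_size mu) * detn (part_length lam)
    (\<lambda>i j. asc_weight q d (lam i) i / asc_weight q d (mu j) j *
       sigma_entry q (int (lam i) - int i - int (mu j) + int j))"
proof -
  define l where "l = part_length lam"
  have mu: "part_length mu \<le> l" using part_length_mono assms l_def by blast
  let ?E = "detn l (\<lambda>i j. sigma_entry q (int (lam i) - int i - int (mu j) + int j))"
  have "detn l (\<lambda>i j. asc_weight q d (lam i) i / asc_weight q d (mu j) j *
       sigma_entry q (int (lam i) - int i - int (mu j) + int j)) =
     (\<Prod>i<l. asc_weight q d (lam i) i) * (\<Prod>j<l. 1 / asc_weight q d (mu j) j) * ?E"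
    by (subst detn_scale[symmetric]) simp
  \<comment> \<open>Row and column factors run over the same range, so they can be paired at equal
    index although inside the determinant they carry different ones.\<close>
  also have "(\<Prod>i<l. asc_weight q d (lam i) i) * (\<Prod>j<l. 1 / asc_weight q d (mu j) j) =
      (\<Prod>i<l. (- 1 / d) powi (int (lam i) - int (mu i)) *
         q powi (int (i * lam i) - int (lam i choose 2) - (int (i * mu i) - int (mu i choose 2))))"
    unfolding prod.distrib[symmetric]
    by (intro prod.cong refl) (subst asc_weight_ratio[OF assms(1,3), symmetric], simp)
  also have "\<dots> = (- 1 / d) powi (int (part_size lam) - int (part_size mu)) *
      q powi (int (part_n (part_transpose mu)) - int (part_n mu) - int (part_n (part_transpose lam)) + int (part_n lam))"
    using assms mu
    by (simp add: prod.distrib prod_power_int sum_subtractf sum.distrib l_def[symmetric] algebra_simps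
        part_size_eq[of _ l] part_n_eq[of _ l] part_n_transpose_eq[of _ l])
  \<comment> \<open>The surplus \<open>c ^ part_size mu\<close> is what the rescaling of variables
    removes, which is why the lemma carries its inverse.\<close>
  also have "(- 1 / d) powi (int (part_size lam) - int (part_size mu)) =
      c ^ part_size mu * (c powi - int (part_size lam) * (- (c / d)) powi (int (part_size lam) - int (part_size mu)))"
  proof -
    have "- (c / d) = c * (- 1 / d)" by simp
    thus ?thesis
      using assms(2,3) by (simp only: power_int_mult_distrib) (simp add: power_int_diff power_int_minus field_simps)
  qed
  finally show ?thesis
    using assms(2) by (simp add: sigma_ASC_def l_def)
qed

text \<open>The parameter is moved from the nodes to the variables, matching the form
  \<open>sym_scale\<close> has in the limit.\<close>

lemma lookup_interp_schur_scaled: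
  assumes "c \<noteq> 0" "is_partition mu" "part_length mu \<le> N"
  shows "Poly_Mapping.lookup (interp_schur N (\<lambda>i. cs i / c) mu) m =
    inverse (c ^ part_size mu) * (c ^ mdeg m * Poly_Mapping.lookup (interp_schur N cs mu) m)"
proof -
  have "c ^ mdeg m * Poly_Mapping.lookup (interp_schur N cs mu) m =
      c ^ part_size mu * Poly_Mapping.lookup (interp_schur N (\<lambda>i. cs i / c) mu) m"
    using arg_cong[OF scale_vars_interp_schur[OF assms(1), of N cs mu], of "\<lambda>p. Poly_Mapping.lookup p m"]
    by (simp add: lookup_scale_vars Const_mult_lookup part_size_eq[OF assms(2,3)] power_sum)
  thus ?thesis using assms(1) by simp
qed

theorem theorem6p3:
  fixes q :: real and c d :: complex and lam :: "nat \<Rightarrow> nat"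
  assumes "0 < q" and "q < 1"
    and "ASC_admissible q c d"
    and "is_partition lam"
  shows "sym_converges (part_length lam)
           (\<lambda>N. ASC_polyN N (complex_of_real q)
                  (c * complex_of_real q powi (1 - int N))
                  (d * complex_of_real q powi (1 - int N)) lam)
           (Phi_ASC (complex_of_real q) c d lam)"
proof -
  define Q where "Q = complex_of_real q"
  have Q: "norm Q < 1" "Q \<noteq> 0" using assms(1,2) by (auto simp: Q_def)
  have Q1: "Q ^ Suc n \<noteq> 1" for n
  proof
    assume "Q ^ Suc n = 1"
    hence "norm Q ^ Suc n = 1" by (metis norm_one norm_power)
    thus False using power_Suc_less_one[of "norm Q" n] Q by simp
  qed
  have cd: "c \<noteq> 0" "d \<noteq> 0" using assms(3) by (auto simp: ASC_admissible_def)
  define l where "l = part_length lam"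
  define c' where "c' N = c * Q powi (1 - int N)" for N
  define d' where "d' N = d * Q powi (1 - int N)" for N
  define cs where "cs N i = Q powi (int N - 1 - int i)" for N i
  have cd': "c' N \<noteq> 0" "d' N \<noteq> 0" for N using Q cd by (auto simp: c'_def d'_def)
  have poly: "ASC_poly Q (c' N) (d' N) n = asc_sum Q (c' N) (d' N) n" for N n
    by (rule ASC_poly_eq[OF Q1 Q(2) cd'])
  define F where "F N = det_quotient N (ASC_poly Q (c' N) (d' N)) lam" for N
  have SymN: "F N \<in> SymN_le (part_size lam) N" if "l \<le> N" for N
    unfolding F_def
    by (rule det_quotient_SymN_le[OF assms(4) that[unfolded l_def]])
       (use asc_sum_monic[OF Q1 Q(2)] in \<open>simp_all only: poly\<close>)
  have lookup: "Poly_Mapping.lookup (F N) m =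
      (\<Sum>mu | is_partition mu \<and> part_subset mu lam.
         detn l (\<lambda>i j. asc_coeff Q (d' N) (lam i + N - 1 - i) (mu j + N - 1 - j)) *
         (inverse (c ^ part_size mu) * (c ^ mdeg m * Poly_Mapping.lookup (interp_schur N (cs N) mu) m)))"
    if N: "l \<le> N" for N m
  proof -
    have nodes: "1 / (c' N * Q ^ i) = cs N i / c" for i
      using Q(2) cd(1) by (simp add: c'_def cs_def power_int_diff power_int_add field_simps)
    have "Poly_Mapping.lookup (F N) m =
      (\<Sum>mu | is_partition mu \<and> part_subset mu lam.
         detn l (\<lambda>i j. asc_coeff Q (d' N) (lam i + N - 1 - i) (mu j + N - 1 - j)) *
         Poly_Mapping.lookup (det_quotient N (shifted_power (\<lambda>i. cs N i / c)) mu) m)"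
      unfolding F_def l_def
    proof (rule lookup_det_quotient_expand[OF assms(4) N[unfolded l_def]])
      show "ASC_poly Q (c' N) (d' N) n = (\<Sum>k\<le>n. smult (asc_coeff Q (d' N) n k) (shifted_power (\<lambda>i. cs N i / c) k))" for n
        unfolding poly asc_sum_def nodes ..
    qed (simp_all only: asc_coeff_self[OF Q1 Q(2)], simp add: asc_coeff_def)
    also have "\<dots> = (\<Sum>mu | is_partition mu \<and> part_subset mu lam.
         detn l (\<lambda>i j. asc_coeff Q (d' N) (lam i + N - 1 - i) (mu j + N - 1 - j)) *
         (inverse (c ^ part_size mu) * (c ^ mdeg m * Poly_Mapping.lookup (interp_schur N (cs N) mu) m)))"
    proof (intro sum.cong refl arg_cong2[of _ _ _ _ "(*)"])
      fix mu assume "mu \<in> {mu. is_partition mu \<and> part_subset mu lam}"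
      hence "is_partition mu" "part_length mu \<le> N"
        using part_length_mono[of mu lam] assms(4) N by (auto simp: l_def)
      from lookup_interp_schur_scaled[OF cd(1) this]
      show "Poly_Mapping.lookup (det_quotient N (shifted_power (\<lambda>i. cs N i / c)) mu) m =
          inverse (c ^ part_size mu) * (c ^ mdeg m * Poly_Mapping.lookup (interp_schur N (cs N) mu) m)"
        unfolding interp_schur_def .
    qed
    finally show ?thesis .
  qed
  have lim: "(\<lambda>N. Poly_Mapping.lookup (F N) m) \<longlonglongrightarrow> Phi_ASC Q c d lam m" for m
  proof -
    have "(\<lambda>N. detn l (\<lambda>i j. asc_coeff Q (d' N) (lam i + N - 1 - i) (mu j + N - 1 - j)) *
         (inverse (c ^ part_size mu) * (c ^ mdeg m * Poly_Mapping.lookup (interp_schur N (cs N) mu) m)))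
       \<longlonglongrightarrow> sigma_ASC Q c d lam mu * sym_scale c (I_A Q mu) m"
      if mu: "is_partition mu" "part_subset mu lam" for mu
    proof -
      have "(\<lambda>N. detn l (\<lambda>i j. asc_coeff Q (d' N) (lam i + N - 1 - i) (mu j + N - 1 - j)) *
         (inverse (c ^ part_size mu) * (c ^ mdeg m * Poly_Mapping.lookup (interp_schur N (cs N) mu) m)))
       \<longlonglongrightarrow> detn l (\<lambda>i j. asc_weight Q d (lam i) i / asc_weight Q d (mu j) j *
           sigma_entry Q (int (lam i) - int i - int (mu j) + int j)) *
         (inverse (c ^ part_size mu) * (c ^ mdeg m * I_A Q mu m))"
        unfolding d'_def cs_def
        by (intro tendsto_mult tendsto_const tendsto_detn asc_coeff_tendsto Q Q1 cd
            sym_convergesD[OF I_A_converges[OF Q mu(1)]])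
      thus ?thesis
        unfolding sigma_ASC_eq[OF Q(2) cd assms(4) mu] sym_scale_def l_def by (simp add: mult_ac)
    qed
    \<comment> \<open>The partitions inside \<open>lam\<close> do not depend on \<open>N\<close>, so
      the limit passes through the sum term by term.\<close>
    hence "(\<lambda>N. \<Sum>mu | is_partition mu \<and> part_subset mu lam.
         detn l (\<lambda>i j. asc_coeff Q (d' N) (lam i + N - 1 - i) (mu j + N - 1 - j)) *
         (inverse (c ^ part_size mu) * (c ^ mdeg m * Poly_Mapping.lookup (interp_schur N (cs N) mu) m)))
       \<longlonglongrightarrow> Phi_ASC Q c d lam m"
      unfolding Phi_ASC_def by (intro tendsto_sum) auto
    \<comment> \<open>The expansion is available from \<open>N = l\<close> on, hence
      eventually.\<close>
    thus ?thesis
      by (rule Lim_transform_eventually) (rule eventually_sequentiallyI[of l], rule lookup[symmetric])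
  qed
  have "sym_converges (part_length lam) F (Phi_ASC Q c d lam)"
    using SymN lim unfolding l_def by (rule sym_convergesI)
  thus ?thesis unfolding F_def ASC_polyN_def c'_def d'_def Q_def .
qed

end
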